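(* Let $n\ge1$ and let $\mathbf{m}=(m_1,\dots,m_n)$, $\mathbf{r}=(r_1,\dots,r_n)$ be vectors of positive integers with $r_j\ge m_j+1$ for all $j\in\{1,\dots,n\}$, and let $m=m_1+\cdots+m_n$. Then the colored multiset Eulerian polynomial $A_{\mathbf{m}}^{\mathbf{r}}$ is real-rooted, log-concave, unimodal, alternatingly increasing and bi-$\gamma$-positive, and its $\mathcal{I}_m$-decomposition is real-rooted, log-concave and unimodal.
   Context: A colored multiset permutation in $\mathfrak{S}_{\mathbf{m}}^{\mathbf{r}}$ is a word $\pi^{\mathbf{c}}=\pi_1^{c_1}\cdots\pi_m^{c_m}$ in which each $k\in\{1,\dots,n\}$ appears exactly $m_k$ times among $\pi_1,\dots,\pi_m$, and $1\le c_j\le r_{\pi_j}$ for all $j$. One always appends $\pi_{m+1}^{c_{m+1}}:=(n+1)^1$. Colored letters are totally ordered by $k^{c}<l^{c'}$ iff $c<c'$, or $c=c'$ and $k<l$. A descent is an index $j\in\{1,\dots,m\}$ with $\pi_j^{c_j}>\pi_{j+1}^{c_{j+1}}$, and $\mathrm{des}(\pi^{\mathbf{c}})$ is the number of descents. The colored multiset Eulerian polynomial is $A_{\mathbf{m}}^{\mathbf{r}}=\sum_{\pi^{\mathbf{c}}\in\mathfrak{S}_{\mathbf{m}}^{\mathbf{r}}}x^{\mathrm{des}(\pi^{\mathbf{c}})}$. Let $p=p_0+p_1x+\cdots+p_dx^d$ have degree $d$. $p$ is real-rooted if it is constant (possibly zero) or all its zeros are real; log-concave if $p_i^2\ge p_{i-1}p_{i+1}$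 for all $i$; unimodal if $p_0\le\cdots\le p_s\ge\cdots\ge p_d$ for some $s$; alternatingly increasing if $p_0\le p_d\le p_1\le p_{d-1}\le\cdots\le p_{\lfloor (d+1)/2\rfloor}$. (The zero polynomial is regarded as having all these properties.) A polynomial $p$ of degree at most $N$ is symmetric with respect to $N$ if $p_s=p_{N-s}$ for $0\le s\le N$; such a $p$ is $\gamma$-positive if its coefficients in the basis $\{x^i(1+x)^{N-2i}:0\le i\le\lfloor N/2\rfloor\}$ are all nonnegative. For a polynomial $p$ of degree at most $N$, its $\mathcal{I}_N$-decomposition (symmetric decomposition with respect to $N$) is the unique pair $(a,b)$ of real polynomials with $p=a+xb$, $\deg a\le N$, $\deg b\le N-1$, $a$ symmetric with respect to $N$ and $b$ symmetric with respect to $N-1$. The decomposition is real-rooted (log-concave, unimodal) if both $a$ and $b$ are; $p$ is bi-$\gamma$-positive if both $a$ and $b$ are $\gamma$-positive ($a$ with respect to $N$, $b$ with respect to $N-1$); here $N=m$. *)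

theory Defs
  imports "HOL-Computational_Algebra.Polynomial" Complex_Main
begin

text \<open>
  A colored letter \<open>k\<^sup>c\<close> is the pair \<open>(k, c)\<close>; a colored word is a list of such pairs.
  The vectors \<open>(m\<^sub>1, \<dots>, m\<^sub>n)\<close> and \<open>(r\<^sub>1, \<dots>, r\<^sub>n)\<close> are functions of which only the values on
  \<open>{1..n}\<close> matter.
\<close>

definition colored_multiset_perms ::
    "nat \<Rightarrow> (nat \<Rightarrow> nat) \<Rightarrow> (nat \<Rightarrow> nat) \<Rightarrow> (nat \<times> nat) list set" where
  "colored_multiset_perms n m r =
     {w. length w = (\<Sum>k=1..n. m k)
         \<and> set w \<subseteq> (SIGMA k:{1..n}. {1..r k})
         \<and> (\<forall>k\<in>{1..n}. count_list (map fst w) k = m k)}"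

definition colored_less :: "nat \<times> nat \<Rightarrow> nat \<times> nat \<Rightarrow> bool" where
  "colored_less = (\<lambda>(k, c) (l, c'). c < c' \<or> c = c' \<and> k < l)"

text \<open>Positions are counted from 0; the letter \<open>(n+1)\<^sup>1\<close> is appended to the word.\<close>

definition des :: "nat \<Rightarrow> (nat \<times> nat) list \<Rightarrow> nat" where
  "des n w = card {j. j < length w \<and>
     colored_less ((w @ [(n + 1, 1)]) ! (j + 1)) ((w @ [(n + 1, 1)]) ! j)}"

definition colored_multiset_Eulerian ::
    "nat \<Rightarrow> (nat \<Rightarrow> nat) \<Rightarrow> (nat \<Rightarrow> nat) \<Rightarrow> real poly" where
  "colored_multiset_Eulerian n m r = (\<Sum>w\<in>colored_multiset_perms n m r. monom 1 (des n w))"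

lemma finite_colored_multiset_perms: "finite (colored_multiset_perms n m r)"
proof (rule finite_subset)
  show "colored_multiset_perms n m r \<subseteq>
      {w. set w \<subseteq> (SIGMA k:{1..n}. {1..r k}) \<and> length w = (\<Sum>k=1..n. m k)}"
    by (auto simp: colored_multiset_perms_def)
  show "finite \<dots>"
    by (rule finite_lists_length_eq) auto
qed

definition real_rooted :: "real poly \<Rightarrow> bool" where
  "real_rooted p \<longleftrightarrow>
     degree p = 0 \<or> (\<forall>z::complex. poly (map_poly of_real p) z = 0 \<longrightarrow> z \<in> \<real>)"

text \<open>For \<open>i = 0\<close> the inequality holds trivially, the coefficient of index \<open>-1\<close> being zero.\<close>

definition log_concave :: "real poly \<Rightarrow> bool" where
  "log_concave p \<longleftrightarrow> (\<forall>i\<ge>1. (coeff p i)\<^sup>2 \<ge> coeff p (i - 1) * coeff p (i + 1))"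

definition unimodal :: "real poly \<Rightarrow> bool" where
  "unimodal p \<longleftrightarrow> (\<exists>s\<le>degree p.
     (\<forall>i<s. coeff p i \<le> coeff p (i + 1)) \<and>
     (\<forall>i\<in>{s..<degree p}. coeff p i \<ge> coeff p (i + 1)))"

text \<open>The sequence of indices \<open>0, d, 1, d - 1, \<dots>, (d + 1) div 2\<close>, of length \<open>d + 1\<close>.\<close>

definition alternating_index :: "nat \<Rightarrow> nat \<Rightarrow> nat" where
  "alternating_index d t = (if even t then t div 2 else d - t div 2)"

lemma alternating_index_last: "alternating_index d d = (d + 1) div 2"
  by (auto simp: alternating_index_def elim!: evenE oddE)

definition alternatingly_increasing :: "real poly \<Rightarrow> bool" where
  "alternatingly_increasing p \<longleftrightarrow> (\<forall>t<degree p.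
     coeff p (alternating_index (degree p) t) \<le> coeff p (alternating_index (degree p) (t + 1)))"

definition symmetric_wrt :: "nat \<Rightarrow> real poly \<Rightarrow> bool" where
  "symmetric_wrt N p \<longleftrightarrow> degree p \<le> N \<and> (\<forall>s\<le>N. coeff p s = coeff p (N - s))"

definition gamma_positive :: "nat \<Rightarrow> real poly \<Rightarrow> bool" where
  "gamma_positive N p \<longleftrightarrow> symmetric_wrt N p \<and>
     (\<exists>\<gamma>::nat \<Rightarrow> real. (\<forall>i\<le>N div 2. \<gamma> i \<ge> 0) \<and>
        p = (\<Sum>i\<le>N div 2. smult (\<gamma> i) ([:0, 1:] ^ i * [:1, 1:] ^ (N - 2 * i))))"

text \<open>For \<open>N = 0\<close> the bound \<open>N - 1\<close> on the degree of \<open>b\<close> forces \<open>b = 0\<close>.\<close>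

definition is_symmetric_decomposition :: "nat \<Rightarrow> real poly \<Rightarrow> real poly \<times> real poly \<Rightarrow> bool" where
  "is_symmetric_decomposition N p = (\<lambda>(a, b).
     p = a + [:0, 1:] * b \<and> symmetric_wrt N a \<and>
     (if N = 0 then b = 0 else symmetric_wrt (N - 1) b))"

lemma ex1_symmetric_decomposition:
  assumes deg: "degree p \<le> N"
  shows "\<exists>!ab. is_symmetric_decomposition N p ab"
proof (rule ex_ex1I)
  define g where "g k = coeff p (N - k) - coeff p k" for k
  define b where "b = (\<Sum>i<N. monom (\<Sum>k\<le>i. g k) i)"
  define a where "a = p - [:0, 1:] * b"
  have cb: "coeff b i = (if i < N then \<Sum>k\<le>i. g k else 0)" for i
    by (simp add: b_def coeff_sum)
  have anti: "g (N - k) = - g k" if "k \<le> N" for k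
    using that by (simp add: g_def)
  have flip: "(\<Sum>k\<in>{N-i..N}. g k) = - (\<Sum>k\<le>i. g k)" if "i \<le> N" for i
  proof -
    have "(\<Sum>k\<in>{N-i..N}. g k) = (\<Sum>k\<le>i. g (N - k))"
      by (rule sum.reindex_bij_witness[of _ "\<lambda>k. N - k" "\<lambda>k. N - k"]) (use that in auto)
    also have "\<dots> = (\<Sum>k\<le>i. - g k)"
      using that by (intro sum.cong refl anti) auto
    finally show ?thesis by (simp add: sum_negf)
  qed
  have total: "(\<Sum>k\<le>N. g k) = 0"
    using flip[of N] by (simp add: atLeast0AtMost)
  have cb': "coeff b i = (\<Sum>k\<le>i. g k)" if "i \<le> N" for i
    using that total by (cases "i = N") (auto simp: cb)
  have symb: "coeff b (N - 1 - i) = coeff b i" if "i < N" for i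
  proof -
    have "{..N} = {..N-1-i} \<union> {N-i..N}" "{..N-1-i} \<inter> {N-i..N} = {}"
      using that by auto
    then have "(\<Sum>k\<le>N. g k) = (\<Sum>k\<le>N-1-i. g k) + (\<Sum>k\<in>{N-i..N}. g k)"
      by (metis finite_atMost finite_atLeastAtMost sum.union_disjoint)
    then show ?thesis
      using that total flip[of i] by (simp add: cb)
  qed
  have ca: "coeff a i = coeff p i - (if i = 0 then 0 else coeff b (i - 1))" for i
    by (cases i) (simp_all add: a_def)
  have ca': "coeff a i = coeff p (N - i) - coeff b i" if "i \<le> N" for i
  proof (cases i)
    case 0
    then show ?thesis using that by (simp add: ca cb' g_def)
  next
    case (Suc j)
    then show ?thesis using that by (simp add: ca cb' g_def)
  qed
  have "symmetric_wrt N a"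
    unfolding symmetric_wrt_def
  proof (intro conjI allI impI)
    show "degree a \<le> N"
      using deg by (intro degree_le) (auto simp: ca cb coeff_eq_0)
    fix s assume s: "s \<le> N"
    show "coeff a s = coeff a (N - s)"
    proof (cases "s = 0")
      case True
      then show ?thesis using ca'[of N] ca[of 0] by (simp add: cb)
    next
      case False
      then have "coeff b (s - 1) = coeff b (N - s)"
        using symb[of "s - 1"] s by simp
      then show ?thesis
        using ca[of s] ca'[of "N - s"] False s by simp
    qed
  qed
  moreover have "if N = 0 then b = 0 else symmetric_wrt (N - 1) b"
  proof (cases "N = 0")
    case True
    then show ?thesis by (simp add: b_def)
  next
    case False
    have "coeff b s = coeff b (N - 1 - s)" if "s \<le> N - 1" for s
      using symb[of s] that False by linarith
    moreover have "degree b \<le> N - 1"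
      by (intro degree_le) (auto simp: cb)
    ultimately show ?thesis
      using False unfolding symmetric_wrt_def by metis
  qed
  ultimately have "is_symmetric_decomposition N p (a, b)"
    by (simp add: is_symmetric_decomposition_def a_def)
  then show "\<exists>ab. is_symmetric_decomposition N p ab" ..
next
  fix ab ab'
  assume "is_symmetric_decomposition N p ab" "is_symmetric_decomposition N p ab'"
  moreover obtain a b a' b' where ab: "ab = (a, b)" "ab' = (a', b')"
    by (metis surj_pair)
  ultimately have p: "a + [:0, 1:] * b = a' + [:0, 1:] * b'"
    and sa: "symmetric_wrt N a" "symmetric_wrt N a'"
    and sb: "if N = 0 then b = 0 else symmetric_wrt (N - 1) b"
            "if N = 0 then b' = 0 else symmetric_wrt (N - 1) b'"
    by (auto simp: is_symmetric_decomposition_def)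
  define u where "u = a - a'"
  define v where "v = b - b'"
  have cu: "coeff u i = (if i = 0 then 0 else - coeff v (i - 1))" for i
    using arg_cong[OF p, of "\<lambda>q. coeff q i"] by (cases i) (auto simp: u_def v_def)
  have su: "coeff u i = coeff u (N - i)" if "i \<le> N" for i
  proof -
    have "coeff a i = coeff a (N - i)" "coeff a' i = coeff a' (N - i)"
      using sa that unfolding symmetric_wrt_def by blast+
    then show ?thesis unfolding u_def coeff_diff by (rule arg_cong2)
  qed
  have sv: "coeff v i = coeff v (N - 1 - i)" if "i < N" for i
  proof -
    have "N \<noteq> 0" "i \<le> N - 1" using that by auto
    then have "coeff b i = coeff b (N - 1 - i)" "coeff b' i = coeff b' (N - 1 - i)"
      using sb unfolding symmetric_wrt_def if_not_P[OF \<open>N \<noteq> 0\<close>] by blast+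
    then show ?thesis unfolding v_def coeff_diff by (rule arg_cong2)
  qed
  have v0: "coeff v i = 0" if "i < N" for i
    using that
  proof (induction i)
    case 0
    then show ?case using sv[of 0] su[of 0] cu[of 0] cu[of N] by simp
  next
    case (Suc i)
    have "coeff v (Suc i) = coeff v (N - 1 - Suc i)"
      using Suc.prems by (rule sv)
    also have "\<dots> = - coeff u (N - Suc i)"
      using Suc.prems by (simp add: cu)
    also have "\<dots> = - coeff u (Suc i)"
      using su[of "Suc i"] Suc.prems by simp
    also have "\<dots> = coeff v i"
      by (simp add: cu)
    finally show ?case using Suc by simp
  qed
  have v1: "coeff v i = 0" if "i \<ge> N" for i
  proof (cases "N = 0")
    case True
    then show ?thesis using sb by (simp add: v_def)
  next
    case False
    then have "degree b < i" "degree b' < i"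
      using sb that by (auto simp: symmetric_wrt_def)
    then show ?thesis by (simp add: v_def coeff_eq_0)
  qed
  have "coeff v i = 0" for i
    using v0[of i] v1[of i] by (cases "i < N") auto
  then have "v = 0"
    by (intro poly_eqI) simp
  moreover from this have "u = 0"
    by (intro poly_eqI) (simp add: cu)
  ultimately show "ab = ab'"
    by (simp add: ab u_def v_def)
qed

definition symmetric_decomposition :: "nat \<Rightarrow> real poly \<Rightarrow> real poly \<times> real poly" where
  "symmetric_decomposition N p = (THE ab. is_symmetric_decomposition N p ab)"

definition bi_gamma_positive :: "nat \<Rightarrow> real poly \<Rightarrow> bool" where
  "bi_gamma_positive N p \<longleftrightarrow>
     (case symmetric_decomposition N p of
        (a, b) \<Rightarrow> gamma_positive N a \<and> gamma_positive (N - 1) b)"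

end

theory Submission
  imports Defs "HOL-Computational_Algebra.Computational_Algebra"
begin

text \<open>
  Counting letters level by level gives the Worpitzky identity
  \<open>\<Sum>w. (t + M - des w) choose M = \<Prod>k. (r k * t + m k) choose m k\<close>. The right-hand side is a constant
  times the product of the factors \<open>r k * t + j = j * (1 + t) + (r k - j) * t\<close> with \<open>1 \<le> j \<le> m k\<close>,
  hence a nonnegative combination \<open>\<Sum>i. c i * t ^ i * (1 + t) ^ (M - i)\<close>. So
  \<open>A = \<Sum>i. c i * T M i\<close>, where \<open>T d i / (1 - x) ^ (d + 1)\<close> is the generating function of
  \<open>t ^ i * (1 + t) ^ (d - i)\<close>. These polynomials satisfy
  \<open>T (d + 1) i = x * (\<Sum>k<i. T d k) + (\<Sum>k\<ge>i. T d k)\<close>.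

  Let \<open>e = M - 1\<close> and let \<open>C k\<close> be the partial sums of \<open>c\<close>. One application of the recursion gives
  \<open>A = \<Sum>k. (C k + x * (C M - C k)) * T e k\<close>. As \<open>T e k\<close> is the reversal of \<open>T e (e - k)\<close>, the symmetric
  decomposition of \<open>A\<close> is \<open>a = \<Sum>k. (C k + x * C (e - k)) * T e k\<close>,
  \<open>b = \<Sum>k. (C M - C (e - k) - C k) * T e k\<close>. The weights of \<open>b\<close> are nonnegative because, for fixed \<open>k\<close>,
  the numbers \<open>r k - j\<close> in increasing order dominate the numbers \<open>j\<close> term by term, as \<open>r k > m k\<close>.

  Real-rootedness is proved pointwise: at a point \<open>z\<close> of the upper half-plane the values of
  \<open>T d 0, \<dots>, T d d\<close> are nonzero and their arguments increase by at most \<open>arg z\<close> in total. The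
  recursion preserves this, and it implies \<open>\<Sum>k. (u k + z * v k) * T e k \<noteq> 0\<close> for positive weights with
  \<open>u\<close> increasing and \<open>v\<close> decreasing. The remaining properties follow from real-rootedness and
  nonnegativity of the coefficients.
\<close>

section \<open>A Worpitzky identity for colored words\<close>

text \<open>The appended letter is a parameter because it moves in the induction: deleting the last
  letter of a word makes that letter the new boundary.\<close>

definition boundary_des :: "'a::linorder \<Rightarrow> 'a list \<Rightarrow> nat" where
  "boundary_des v xs = card {j. j < length xs \<and> (xs @ [v]) ! (j + 1) < (xs @ [v]) ! j}"

lemma boundary_des_Nil [simp]: "boundary_des v [] = 0"
  by (simp add: boundary_des_def)

lemma boundary_des_snoc [simp]:
  "boundary_des v (xs @ [x]) = boundary_des x xs + (if v < x then 1 else 0)"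
proof -
  let ?A = "{j. j < length xs \<and> (xs @ [x]) ! (j + 1) < (xs @ [x]) ! j}"
  have "{j. j < length (xs @ [x]) \<and> ((xs @ [x]) @ [v]) ! (j + 1) < ((xs @ [x]) @ [v]) ! j} =
      ?A \<union> (if v < x then {length xs} else {})"
    by (auto simp: nth_append less_Suc_eq split: if_splits)
  moreover have "?A \<inter> (if v < x then {length xs} else {}) = {}" by auto
  ultimately show ?thesis
    unfolding boundary_des_def by (simp add: card_Un_disjoint)
qed

lemma boundary_des_le: "boundary_des v xs \<le> length xs"
  unfolding boundary_des_def by (rule order.trans[OF card_mono[of "{..<length xs}"]]) auto

text \<open>The color is the leading digit in base \<open>n + 2\<close>, which exceeds every letter
  including the appended \<open>n + 1\<close>. Ranks turn the order of colored letters into that of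
  the natural numbers, so that a boundary can be moved one unit at a time.\<close>

definition letter_rank :: "nat \<Rightarrow> nat \<times> nat \<Rightarrow> nat" where
  "letter_rank n = (\<lambda>(k, c). c * (n + 2) + k)"

lemma letter_rank_less_iff:
  assumes "k \<le> n + 1" "l \<le> n + 1"
  shows "letter_rank n (k, c) < letter_rank n (l, c') \<longleftrightarrow> colored_less (k, c) (l, c')"
proof -
  have *: "c * (n + 2) + k < c' * (n + 2) + l" if "c < c'" "k \<le> n + 1" for c c' k l
  proof -
    have "c * (n + 2) + k < (c + 1) * (n + 2)" using that by simp
    also have "\<dots> \<le> c' * (n + 2)" using that by (intro mult_right_mono) auto
    finally show ?thesis by simp
  qed
  show ?thesis
    using *[of c c' k l] *[of c' c l k] assms
    by (cases c c' rule: linorder_cases) (auto simp: letter_rank_def colored_less_def)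
qed

lemma letter_rank_eq_iff:
  assumes "k \<le> n + 1" "l \<le> n + 1"
  shows "letter_rank n (k, c) = letter_rank n (l, c') \<longleftrightarrow> k = l \<and> c = c'"
proof
  assume a: "letter_rank n (k, c) = letter_rank n (l, c')"
  then have "\<not> colored_less (k, c) (l, c')" "\<not> colored_less (l, c') (k, c)"
    using letter_rank_less_iff assms by (metis less_irrefl)+
  then show "k = l \<and> c = c'" by (auto simp: colored_less_def)
qed auto

lemma des_eq_boundary_des:
  assumes "set w \<subseteq> (SIGMA k:{1..n}. C k)"
  shows "des n w = boundary_des (letter_rank n (n + 1, 1)) (map (letter_rank n) w)"
proof -
  have "letter_rank n ((w @ [(n + 1, 1)]) ! i) = (map (letter_rank n) w @ [letter_rank n (n + 1, 1)]) ! i"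
    if "i \<le> length w" for i
    using that by (auto simp: nth_append)
  moreover have "fst ((w @ [(n + 1, 1)]) ! i) \<le> n + 1" if "i \<le> length w" for i
  proof (cases "i < length w")
    case True
    then have "w ! i \<in> (SIGMA k:{1..n}. C k)" using assms nth_mem by blast
    then have "fst (w ! i) \<le> n" by auto
    with True show ?thesis by (simp add: nth_append)
  qed (use that in \<open>simp add: nth_append\<close>)
  ultimately have "colored_less ((w @ [(n + 1, 1)]) ! (j + 1)) ((w @ [(n + 1, 1)]) ! j) \<longleftrightarrow>
      (map (letter_rank n) w @ [letter_rank n (n + 1, 1)]) ! (j + 1)
        < (map (letter_rank n) w @ [letter_rank n (n + 1, 1)]) ! j" if "j < length w" for j
    using that letter_rank_less_iff[of "fst ((w @ [(n + 1, 1)]) ! (j + 1))" n "fst ((w @ [(n + 1, 1)]) ! j)"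
      "snd ((w @ [(n + 1, 1)]) ! (j + 1))" "snd ((w @ [(n + 1, 1)]) ! j)"]
    by (metis Suc_eq_plus1 less_imp_le Suc_leI prod.collapse)
  then show ?thesis
    unfolding des_def boundary_des_def by (intro arg_cong[of _ _ card]) auto
qed

section \<open>Recursion for the count of levelled words\<close>

lemma colored_multiset_perms_snoc:
  assumes m: "\<And>j. j \<in> {1..n} \<Longrightarrow> m j = m' j + (if j = k then 1 else 0)"
    and k: "k \<in> {1..n}"
  shows "w @ [(k, c)] \<in> colored_multiset_perms n m r \<longleftrightarrow>
    w \<in> colored_multiset_perms n m' r \<and> c \<in> {1..r k}"
proof -
  have "(\<Sum>j=1..n. m j) = (\<Sum>j=1..n. m' j + (if j = k then 1 else 0))"
    by (intro sum.cong) (auto simp: m)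
  also have "\<dots> = (\<Sum>j=1..n. m' j) + 1" using k by (simp add: sum.distrib)
  finally have "(\<Sum>j=1..n. m j) = (\<Sum>j=1..n. m' j) + 1" .
  then show ?thesis
    using k m unfolding colored_multiset_perms_def by (auto split: if_splits)
qed

text \<open>Counts the pairs of a word in the letters of \<open>colored_multiset_perms n m r\<close> and a weakly
  increasing sequence of levels \<open>0, \<dots>, t\<close> that increases strictly at the descents, where the
  letters on level \<open>t\<close> have rank at most \<open>v\<close>.\<close>

definition levelled_word_count ::
    "nat \<Rightarrow> (nat \<Rightarrow> nat) \<Rightarrow> (nat \<Rightarrow> nat) \<Rightarrow> nat \<Rightarrow> nat \<Rightarrow> nat" where
  "levelled_word_count n r m t v = (\<Sum>w\<in>colored_multiset_perms n m r.
     (t + sum m {1..n} - boundary_des v (map (letter_rank n) w)) choose (sum m {1..n}))"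

lemma levelled_word_count_empty:
  assumes "sum m {1..n} = 0"
  shows "levelled_word_count n r m t v = 1"
proof -
  have "\<forall>k\<in>{1..n}. m k = 0" using assms by simp
  then have "colored_multiset_perms n m r = {[]}"
    by (auto simp: colored_multiset_perms_def)
  then show ?thesis using assms by (simp add: levelled_word_count_def)
qed

text \<open>Only a word whose last letter has rank \<open>Suc v\<close> notices the move of the
  boundary from \<open>v\<close> to \<open>Suc v\<close>; under the hypothesis there is no such
  word.\<close>

lemma levelled_word_count_step_none:
  assumes "\<And>k c. k \<in> {1..n} \<Longrightarrow> c \<in> {1..r k} \<Longrightarrow> m k > 0 \<Longrightarrow> letter_rank n (k, c) \<noteq> Suc v"
  shows "levelled_word_count n r m t (Suc v) = levelled_word_count n r m t v"
  unfolding levelled_word_count_def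
proof (intro sum.cong refl)
  fix w assume w: "w \<in> colored_multiset_perms n m r"
  have "boundary_des (Suc v) (map (letter_rank n) w) = boundary_des v (map (letter_rank n) w)"
  proof (cases w rule: rev_cases)
    case (snoc ys y)
    obtain k c where y: "y = (k, c)" by force
    have "k \<in> {1..n}" "c \<in> {1..r k}"
      using w snoc y by (auto simp: colored_multiset_perms_def)
    moreover from this have "count_list (map fst w) k = m k"
      using w by (auto simp: colored_multiset_perms_def)
    then have "m k > 0" using snoc y by auto
    ultimately have "letter_rank n (k, c) \<noteq> Suc v" by (rule assms)
    then show ?thesis by (auto simp: snoc y)
  qed simp
  then show "(t + sum m {1..n} - boundary_des (Suc v) (map (letter_rank n) w)) choose sum m {1..n} =
      (t + sum m {1..n} - boundary_des v (map (letter_rank n) w)) choose sum m {1..n}" by simp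
qed

text \<open>A word ending in \<open>(k, c)\<close> has a final descent for the boundary
  \<open>v\<close> but not for \<open>Suc v\<close>. Pascal's rule turns the lost descent into the
  count for the word without that letter, whose boundary is now \<open>Suc v\<close>. All other
  words contribute equally for both boundaries.\<close>

lemma levelled_word_count_step:
  assumes m: "\<And>j. j \<in> {1..n} \<Longrightarrow> m j = m' j + (if j = k then 1 else 0)"
    and k: "k \<in> {1..n}" and c: "c \<in> {1..r k}" and v: "letter_rank n (k, c) = Suc v"
  shows "levelled_word_count n r m t (Suc v) =
    levelled_word_count n r m t v + levelled_word_count n r m' t (Suc v)"
proof -
  let ?W = "colored_multiset_perms n m r" and ?W' = "colored_multiset_perms n m' r"
  let ?g = "map (letter_rank n)"
  define E where "E = (\<lambda>w. w @ [(k, c)]) ` ?W'"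
  have "sum m {1..n} = (\<Sum>j=1..n. m' j + (if j = k then 1 else 0))"
    by (intro sum.cong) (auto simp: m)
  also have "\<dots> = Suc (sum m' {1..n})" using k by (simp add: sum.distrib)
  finally have M: "sum m {1..n} = Suc (sum m' {1..n})" .
  define M' where "M' = sum m' {1..n}"
  have EW: "E \<subseteq> ?W" using colored_multiset_perms_snoc[OF m k] c by (auto simp: E_def)
  have fin: "finite ?W" by (rule finite_colored_multiset_perms)
  define f where "f v w = (t + Suc M' - boundary_des v (?g w)) choose Suc M'" for v w
  have split: "levelled_word_count n r m t v = sum (f v) (?W - E) + sum (f v) E" for v
    unfolding levelled_word_count_def M M'_def[symmetric] f_def
    using sum.subset_diff[OF EW fin] by simp
  have same: "f (Suc v) w = f v w" if "w \<in> ?W - E" for w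
  proof (cases w rule: rev_cases)
    case (snoc ys y)
    obtain l d where y: "y = (l, d)" by force
    have "l \<in> {1..n}" using that snoc y by (auto simp: colored_multiset_perms_def)
    moreover have "(l, d) \<noteq> (k, c)"
      using that snoc y colored_multiset_perms_snoc[OF m k, of ys c] by (auto simp: E_def)
    ultimately have "letter_rank n (l, d) \<noteq> Suc v"
      using letter_rank_eq_iff[of l n k d c] k v by auto
    then have "boundary_des (Suc v) (?g w) = boundary_des v (?g w)" by (auto simp: snoc y)
    then show ?thesis by (simp add: f_def)
  qed (simp add: f_def)
  have inj: "inj_on (\<lambda>w. w @ [(k, c)]) ?W'" by (auto simp: inj_on_def)
  have "sum (f (Suc v)) E = (\<Sum>w\<in>?W'. f (Suc v) (w @ [(k, c)]))"
    unfolding E_def by (rule sum.reindex[OF inj, unfolded comp_def])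
  also have "\<dots> = (\<Sum>w\<in>?W'. f v (w @ [(k, c)])
      + ((t + M' - boundary_des (Suc v) (?g w)) choose M'))"
  proof (intro sum.cong refl)
    fix w assume "w \<in> ?W'"
    then have "boundary_des (Suc v) (?g w) \<le> M'"
      using boundary_des_le[of "Suc v" "?g w"] by (simp add: colored_multiset_perms_def M'_def)
    \<comment> \<open>The bound on the descents makes the truncated subtraction exact, so that
      Pascal's rule applies.\<close>
    then have "t + Suc M' - boundary_des (Suc v) (?g w) = Suc (t + M' - boundary_des (Suc v) (?g w))"
      by simp
    then show "f (Suc v) (w @ [(k, c)]) =
        f v (w @ [(k, c)]) + ((t + M' - boundary_des (Suc v) (?g w)) choose M')"
      by (simp add: f_def v)
  qed
  also have "\<dots> = sum (f v) E + levelled_word_count n r m' t (Suc v)"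
    unfolding E_def sum.reindex[OF inj, unfolded comp_def] levelled_word_count_def M'_def
    by (rule sum.distrib)
  finally show ?thesis using same by (simp add: split)
qed

text \<open>Ranks of letters are positive, so the boundary \<open>0\<close> forces a final descent;
  at level \<open>0\<close> the upper entry of each binomial coefficient then stays below the lower
  one.\<close>

lemma levelled_word_count_0:
  assumes "sum m {1..n} > 0"
  shows "levelled_word_count n r m 0 0 = 0"
  unfolding levelled_word_count_def
proof (intro sum.neutral ballI)
  fix w assume w: "w \<in> colored_multiset_perms n m r"
  have "w \<noteq> []" using w assms by (auto simp: colored_multiset_perms_def)
  then obtain ys k c where y: "w = ys @ [(k, c)]" by (metis rev_exhaust surj_pair)
  have "k > 0" using w y by (auto simp: colored_multiset_perms_def)
  then have "boundary_des 0 (map (letter_rank n) w) > 0"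
    by (auto simp: y letter_rank_def)
  then show "(0 + sum m {1..n} - boundary_des 0 (map (letter_rank n) w)) choose sum m {1..n} = 0"
    using assms by (intro binomial_eq_0) simp
qed

text \<open>The boundary \<open>0\<close> always adds a final descent and the boundary
  \<open>V\<close> never does, which offsets the additional level. This links consecutive levels in
  the induction on \<open>t\<close>.\<close>

lemma levelled_word_count_Suc:
  assumes V: "\<And>k c. k \<in> {1..n} \<Longrightarrow> c \<in> {1..r k} \<Longrightarrow> letter_rank n (k, c) \<le> V"
  shows "levelled_word_count n r m (Suc t) 0 = levelled_word_count n r m t V"
proof (cases "sum m {1..n} = 0")
  case False
  show ?thesis
    unfolding levelled_word_count_def
  proof (intro sum.cong refl)
    fix w assume w: "w \<in> colored_multiset_perms n m r"
    then have "w \<noteq> []" using False by (auto simp: colored_multiset_perms_def)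
    then obtain ys k c where y: "w = ys @ [(k, c)]" by (metis rev_exhaust surj_pair)
    have "k \<in> {1..n}" "c \<in> {1..r k}" using w y by (auto simp: colored_multiset_perms_def)
    then have "letter_rank n (k, c) \<le> V" "letter_rank n (k, c) > 0"
      using V by (auto simp: letter_rank_def)
    then show "(Suc t + sum m {1..n} - boundary_des 0 (map (letter_rank n) w)) choose sum m {1..n} =
        (t + sum m {1..n} - boundary_des V (map (letter_rank n) w)) choose sum m {1..n}"
      by (simp add: y)
  qed
qed (simp add: levelled_word_count_empty)

section \<open>Recursion for the count of levelled multisets\<close>

definition letters_upto :: "nat \<Rightarrow> (nat \<Rightarrow> nat) \<Rightarrow> nat \<Rightarrow> nat \<Rightarrow> nat" where
  "letters_upto n r v k = card {c\<in>{1..r k}. letter_rank n (k, c) \<le> v}"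

lemma letters_upto_0: "k > 0 \<Longrightarrow> letters_upto n r 0 k = 0"
  by (auto simp: letters_upto_def letter_rank_def)

lemma letters_upto_all:
  assumes "\<And>c. c \<in> {1..r k} \<Longrightarrow> letter_rank n (k, c) \<le> V"
  shows "letters_upto n r V k = r k"
proof -
  have "{c\<in>{1..r k}. letter_rank n (k, c) \<le> V} = {1..r k}" using assms by auto
  then show ?thesis by (simp add: letters_upto_def)
qed

lemma letters_upto_Suc_same:
  assumes "\<And>c. c \<in> {1..r k} \<Longrightarrow> letter_rank n (k, c) \<noteq> Suc v"
  shows "letters_upto n r (Suc v) k = letters_upto n r v k"
  unfolding letters_upto_def using assms by (intro arg_cong[of _ _ card]) (auto simp: le_Suc_eq)

lemma letters_upto_Suc:
  assumes "c \<in> {1..r k}" "letter_rank n (k, c) = Suc v" "k \<le> n"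
  shows "letters_upto n r (Suc v) k = Suc (letters_upto n r v k)"
proof -
  have unique: "d = c" if "letter_rank n (k, d) = Suc v" for d
    using letter_rank_eq_iff[of k n k d c] assms that by simp
  have "{d\<in>{1..r k}. letter_rank n (k, d) \<le> Suc v} =
      insert c {d\<in>{1..r k}. letter_rank n (k, d) \<le> v}"
    using assms(1,2) by (auto simp: le_Suc_eq dest: unique)
  moreover have "c \<notin> {d\<in>{1..r k}. letter_rank n (k, d) \<le> v}" using assms by simp
  ultimately show ?thesis by (simp add: letters_upto_def)
qed

text \<open>The number of multisets with \<open>m k\<close> letters of kind \<open>k\<close>, chosen from the
  levelled letters below the boundary \<open>(t, v)\<close>.\<close>

definition levelled_multiset_count ::
    "nat \<Rightarrow> (nat \<Rightarrow> nat) \<Rightarrow> (nat \<Rightarrow> nat) \<Rightarrow> nat \<Rightarrow> nat \<Rightarrow> nat" where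
  "levelled_multiset_count n r m t v =
     (\<Prod>k=1..n. (r k * t + letters_upto n r v k + m k - 1) choose m k)"

lemma levelled_multiset_count_step_none:
  assumes "\<And>k c. k \<in> {1..n} \<Longrightarrow> c \<in> {1..r k} \<Longrightarrow> m k > 0 \<Longrightarrow> letter_rank n (k, c) \<noteq> Suc v"
  shows "levelled_multiset_count n r m t (Suc v) = levelled_multiset_count n r m t v"
  unfolding levelled_multiset_count_def
proof (intro prod.cong refl)
  fix k assume k: "k \<in> {1..n}"
  show "(r k * t + letters_upto n r (Suc v) k + m k - 1) choose m k =
      (r k * t + letters_upto n r v k + m k - 1) choose m k"
    using letters_upto_Suc_same[of r k n v] assms[OF k] by (cases "m k = 0") auto
qed

text \<open>Only the factor of kind \<open>k\<close> changes, gaining one available letter; Pascal's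
  rule splits the selections with repetition by whether they use it. This is the recursion of the
  word count.\<close>

lemma levelled_multiset_count_step:
  assumes m: "\<And>j. j \<in> {1..n} \<Longrightarrow> m j = m' j + (if j = k then 1 else 0)"
    and k: "k \<in> {1..n}" and c: "c \<in> {1..r k}" and v: "letter_rank n (k, c) = Suc v"
  shows "levelled_multiset_count n r m t (Suc v) =
    levelled_multiset_count n r m t v + levelled_multiset_count n r m' t (Suc v)"
proof -
  define P where "P m v = (\<Prod>j\<in>{1..n}-{k}. (r j * t + letters_upto n r v j + m j - 1) choose m j)" for m v
  have split: "levelled_multiset_count n r m t v =
      ((r k * t + letters_upto n r v k + m k - 1) choose m k) * P m v" for m v
    unfolding levelled_multiset_count_def P_def using k by (intro prod.remove) auto
  have "P m (Suc v) = P m v"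
    unfolding P_def
  proof (intro prod.cong refl)
    fix j assume j: "j \<in> {1..n} - {k}"
    then have "letter_rank n (j, d) \<noteq> Suc v" for d
      using letter_rank_eq_iff[of j n k d c] k v by auto
    then have "letters_upto n r (Suc v) j = letters_upto n r v j"
      by (intro letters_upto_Suc_same)
    then show "(r j * t + letters_upto n r (Suc v) j + m j - 1) choose m j =
        (r j * t + letters_upto n r v j + m j - 1) choose m j" by simp
  qed
  moreover have "P m' (Suc v) = P m (Suc v)"
    unfolding P_def using m by (intro prod.cong) auto
  moreover have "m k = Suc (m' k)" using m[OF k] by simp
  moreover have "letters_upto n r (Suc v) k = Suc (letters_upto n r v k)"
    using letters_upto_Suc c v k by auto
  ultimately show ?thesis by (simp add: split algebra_simps)
qed

text \<open>Both counts obey the same recursion in \<open>v\<close>. The inner induction runs on the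
  total multiplicity, because the step refers to the smaller \<open>m'\<close> at the same boundary
  \<open>Suc v\<close>.\<close>

lemma levelled_word_count_boundary:
  assumes base: "\<And>m. levelled_word_count n r m t 0 = levelled_multiset_count n r m t 0"
  shows "levelled_word_count n r m t v = levelled_multiset_count n r m t v"
proof (induction v arbitrary: m)
  case (Suc v)
  show ?case
  proof (induction "sum m {1..n}" arbitrary: m rule: less_induct)
    case less
    show ?case
    proof (cases "\<exists>k c. k \<in> {1..n} \<and> c \<in> {1..r k} \<and> m k > 0 \<and> letter_rank n (k, c) = Suc v")
      case True
      then obtain k c where k: "k \<in> {1..n}" "c \<in> {1..r k}" "m k > 0" "letter_rank n (k, c) = Suc v"
        by blast
      define m' where "m' = m(k := m k - 1)"
      have m': "m j = m' j + (if j = k then 1 else 0)" if "j \<in> {1..n}" for j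
        using k by (simp add: m'_def)
      have "sum m' {1..n} < sum m {1..n}"
        by (rule sum_strict_mono_ex1) (use k in \<open>auto simp: m'_def\<close>)
      then have "levelled_word_count n r m' t (Suc v) = levelled_multiset_count n r m' t (Suc v)"
        by (rule less.hyps)
      then show ?thesis
        by (simp only: Suc.IH levelled_word_count_step[of n m m' k c r v t, OF m' k(1,2,4)]
            levelled_multiset_count_step[of n m m' k c r v t, OF m' k(1,2,4)])
    next
      case False
      then have none: "\<And>k c. k \<in> {1..n} \<Longrightarrow> c \<in> {1..r k} \<Longrightarrow> m k > 0 \<Longrightarrow>
          letter_rank n (k, c) \<noteq> Suc v" by blast
      show ?thesis
        by (simp only: Suc.IH levelled_word_count_step_none[OF none]
            levelled_multiset_count_step_none[OF none])
    qed
  qed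
qed (rule base)

lemma levelled_word_count_eq:
  "levelled_word_count n r m t v = levelled_multiset_count n r m t v"
proof (induction t arbitrary: m v)
  case 0
  show ?case
  proof (rule levelled_word_count_boundary)
    fix m
    show "levelled_word_count n r m 0 0 = levelled_multiset_count n r m 0 0"
    proof (cases "sum m {1..n} = 0")
      case True
      then show ?thesis by (simp add: levelled_word_count_empty levelled_multiset_count_def)
    next
      case False
      then obtain k where k: "k \<in> {1..n}" "m k > 0" by auto
      then have "(r k * 0 + letters_upto n r 0 k + m k - 1) choose m k = 0"
        by (simp add: letters_upto_0)
      then have "levelled_multiset_count n r m 0 0 = 0"
        unfolding levelled_multiset_count_def using k by (intro prod_zero) auto
      then show ?thesis using False levelled_word_count_0[of m n r] by linarith
    qed
  qed
next
  case (Suc t)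
  \<comment> \<open>A boundary at the largest rank lies above all letters of its level, so
    \<open>(t, V)\<close> and \<open>(Suc t, 0)\<close> bound the same set of levelled
    letters.\<close>
  define V where "V = Max (letter_rank n ` (SIGMA k:{1..n}. {1..r k}))"
  have V: "letter_rank n (k, c) \<le> V" if "k \<in> {1..n}" "c \<in> {1..r k}" for k c
    unfolding V_def by (rule Max_ge) (use that in auto)
  show ?case
  proof (rule levelled_word_count_boundary)
    fix m
    have "levelled_multiset_count n r m (Suc t) 0 = levelled_multiset_count n r m t V"
      unfolding levelled_multiset_count_def
    proof (intro prod.cong refl)
      fix k assume "k \<in> {1..n}"
      then show "(r k * Suc t + letters_upto n r 0 k + m k - 1) choose m k =
          (r k * t + letters_upto n r V k + m k - 1) choose m k"
        using letters_upto_all[of r k n V] V by (simp add: letters_upto_0 add_ac)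
    qed
    then show "levelled_word_count n r m (Suc t) 0 = levelled_multiset_count n r m (Suc t) 0"
      using Suc levelled_word_count_Suc[of n r V m t] V by simp
  qed
qed

text \<open>The boundary is placed at the rank of the appended letter. The letters below it are
  those of color 1, one for each \<open>k\<close>, so \<open>letters_upto\<close> is 1 and cancels
  the \<open>- 1\<close> in the multiset count.\<close>

lemma colored_Worpitzky:
  assumes r: "\<And>k. k \<in> {1..n} \<Longrightarrow> r k > 0"
  shows "(\<Sum>w\<in>colored_multiset_perms n m r. (t + sum m {1..n} - des n w) choose (sum m {1..n})) =
    (\<Prod>k=1..n. (r k * t + m k) choose m k)"
proof -
  let ?v = "letter_rank n (n + 1, 1)"
  have "(\<Sum>w\<in>colored_multiset_perms n m r. (t + sum m {1..n} - des n w) choose (sum m {1..n})) =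
      levelled_word_count n r m t ?v"
    unfolding levelled_word_count_def
  proof (intro sum.cong refl)
    fix w assume "w \<in> colored_multiset_perms n m r"
    then have w: "set w \<subseteq> (SIGMA k:{1..n}. {1..r k})" by (simp add: colored_multiset_perms_def)
    then show "(t + sum m {1..n} - des n w) choose sum m {1..n} =
        (t + sum m {1..n} - boundary_des ?v (map (letter_rank n) w)) choose sum m {1..n}"
      by (simp only: des_eq_boundary_des[OF w])
  qed
  also have "\<dots> = levelled_multiset_count n r m t ?v" by (rule levelled_word_count_eq)
  also have "\<dots> = (\<Prod>k=1..n. (r k * t + m k) choose m k)"
    unfolding levelled_multiset_count_def
  proof (intro prod.cong refl)
    fix k assume k: "k \<in> {1..n}"
    have "\<not> ?v < letter_rank n (k, c) \<longleftrightarrow> c \<le> 1" for c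
      using k by (subst letter_rank_less_iff) (auto simp: colored_less_def)
    then have "{c\<in>{1..r k}. letter_rank n (k, c) \<le> ?v} = {c\<in>{1..r k}. c \<le> 1}"
      by (simp only: not_less)
    also have "\<dots> = {1}" using r[OF k] by auto
    finally have "{c\<in>{1..r k}. letter_rank n (k, c) \<le> ?v} = {1}" .
    then have "letters_upto n r ?v k = card {1::nat}" unfolding letters_upto_def by (rule arg_cong)
    then show "(r k * t + letters_upto n r ?v k + m k - 1) choose m k = (r k * t + m k) choose m k"
      by simp
  qed
  finally show ?thesis .
qed

lemma des_le: "des n w \<le> length w"
  unfolding des_def by (rule order.trans[OF card_mono[of "{..<length w}"]]) auto

section \<open>Refined Eulerian polynomials\<close>

lemma fps_one_minus_X_mult:
  "(1 - fps_X) * Abs_fps f = Abs_fps (\<lambda>t. if t = 0 then f 0 else f t - f (t - 1) :: real)"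
  by (rule fps_ext) (simp add: left_diff_distrib)

lemma fps_binomial_series:
  "(1 - fps_X) ^ Suc d * Abs_fps (\<lambda>t. real ((t + d) choose d)) = 1"
proof (induction d)
  case 0
  then show ?case by (simp add: fps_one_minus_X_mult) (simp add: fps_eq_iff)
next
  case (Suc d)
  have "(1 - fps_X) * Abs_fps (\<lambda>t. real ((t + Suc d) choose Suc d)) =
      Abs_fps (\<lambda>t. real ((t + d) choose d))"
    unfolding fps_one_minus_X_mult
  proof (rule fps_ext)
    fix t
    show "Abs_fps (\<lambda>t. if t = 0 then real ((0 + Suc d) choose Suc d)
        else real ((t + Suc d) choose Suc d) - real ((t - 1 + Suc d) choose Suc d)) $ t
      = Abs_fps (\<lambda>t. real ((t + d) choose d)) $ t"
      by (cases t) auto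
  qed
  moreover have "(1 - fps_X) ^ Suc (Suc d) * f = (1 - fps_X) ^ Suc d * ((1 - fps_X) * f)"
    for f :: "real fps"
    by (simp only: power_Suc ac_simps)
  ultimately show ?case
    using Suc by metis
qed

text \<open>For \<open>t < e\<close> the binomial coefficient vanishes, so the series is the
  previous one shifted by \<open>e\<close>.\<close>

lemma fps_shifted_binomial_series:
  assumes "e \<le> d"
  shows "(1 - fps_X) ^ Suc d * Abs_fps (\<lambda>t. real ((t + d - e) choose d)) = fps_X ^ e"
proof -
  have "Abs_fps (\<lambda>t. real ((t + d - e) choose d)) =
      fps_X ^ e * Abs_fps (\<lambda>t. real ((t + d) choose d))"
    by (rule fps_ext) (use assms in \<open>auto simp: fps_X_power_mult_nth binomial_eq_0\<close>)
  then have "(1 - fps_X) ^ Suc d * Abs_fps (\<lambda>t. real ((t + d - e) choose d)) =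
      fps_X ^ e * ((1 - fps_X) ^ Suc d * Abs_fps (\<lambda>t. real ((t + d) choose d)))"
    by (simp only: ac_simps)
  then show ?thesis by (simp only: fps_binomial_series mult_1_right)
qed

text \<open>For \<open>i \<le> d\<close> this is the descent polynomial of the permutations of
  \<open>d + 1\<close> letters with first letter \<open>i + 1\<close>. The recursion sums over the
  relative rank of the second letter, with a factor \<open>x\<close> when a descent arises.\<close>

fun refined_Eulerian :: "nat \<Rightarrow> nat \<Rightarrow> real poly" where
  "refined_Eulerian 0 i = 1"
| "refined_Eulerian (Suc d) i = (\<Sum>k\<le>d. (if k < i then [:0, 1:] else 1) * refined_Eulerian d k)"


text \<open>Since \<open>(1 + y) - y = 1\<close>, each \<open>y ^ k * (1 + y) ^ (d - k)\<close> is a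
  difference of two consecutive such products of degree \<open>d + 1\<close>. The terms with
  \<open>k \<ge> i\<close> telescope at \<open>t\<close>, those with \<open>k < i\<close> at
  \<open>t - 1\<close>; the powers \<open>t ^ (d + 1)\<close> cancel and a backward difference
  remains.\<close>

lemma fps_refined_Eulerian:
  assumes "i \<le> d"
  shows "fps_of_poly (refined_Eulerian d i) =
    (1 - fps_X) ^ Suc d * Abs_fps (\<lambda>t. real t ^ i * (1 + real t) ^ (d - i))"
  using assms
proof (induction d arbitrary: i)
  case 0
  then show ?case by (simp add: fps_one_minus_X_mult) (simp add: fps_eq_iff)
next
  case (Suc d)
  define F where "F d i = Abs_fps (\<lambda>t. real t ^ i * (1 + real t) ^ (d - i))" for d i
  have tele: "(\<Sum>k\<in>{i..<j}. y ^ k * (1 + y) ^ (d - k)) =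
      y ^ i * (1 + y) ^ (Suc d - i) - y ^ j * (1 + y) ^ (Suc d - j)"
    if "i \<le> j" "j \<le> Suc d" for y :: real and i j
    using that
  proof (induction j rule: dec_induct)
    case (step j)
    then have "Suc d - j = Suc (d - j)" by simp
    with step show ?case by (simp add: algebra_simps)
  qed simp
  have "(\<Sum>k\<le>d. (if k < i then fps_X else 1) * F d k) = (1 - fps_X) * F (Suc d) i"
  proof (rule fps_ext)
    fix t
    have "{..d} = {0..<i} \<union> {i..<Suc d}" using Suc.prems by auto
    then have eq: "(\<Sum>k\<le>d. ((if k < i then fps_X else 1) * F d k) $ t) =
        (\<Sum>k\<in>{0..<i}. (fps_X * F d k) $ t) + (\<Sum>k\<in>{i..<Suc d}. F d k $ t)"
      by (simp add: sum.union_disjoint ivl_disj_int)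
    show "(\<Sum>k\<le>d. (if k < i then fps_X else 1) * F d k) $ t = ((1 - fps_X) * F (Suc d) i) $ t"
    proof (cases t)
      case 0
      then show ?thesis
        using eq tele[of i "Suc d" "real t"] Suc.prems
        by (simp add: fps_sum_nth F_def fps_one_minus_X_mult)
    next
      case (Suc s)
      have "(\<Sum>k\<in>{0..<i}. (fps_X * F d k) $ t) = (\<Sum>k\<in>{0..<i}. real s ^ k * (1 + real s) ^ (d - k))"
        by (simp add: F_def Suc)
      also have "\<dots> = (1 + real s) ^ Suc d - real s ^ i * (1 + real s) ^ (Suc d - i)"
        using tele[of 0 i "real s"] Suc.prems by simp
      finally have "(\<Sum>k\<le>d. (if k < i then fps_X else 1) * F d k) $ t =
        (1 + real s) ^ Suc d - real s ^ i * (1 + real s) ^ (Suc d - i)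
          + (real t ^ i * (1 + real t) ^ (Suc d - i) - real t ^ Suc d)"
        using eq tele[of i "Suc d" "real t"] Suc.prems by (simp add: fps_sum_nth F_def)
      also have "\<dots> = ((1 - fps_X) * F (Suc d) i) $ t"
        by (simp add: F_def fps_one_minus_X_mult Suc)
      finally show ?thesis .
    qed
  qed
  moreover have "fps_of_poly (refined_Eulerian (Suc d) i) =
      (1 - fps_X) ^ Suc d * (\<Sum>k\<le>d. (if k < i then fps_X else 1) * F d k)"
  proof -
    have "fps_of_poly (refined_Eulerian (Suc d) i) =
      (\<Sum>k\<le>d. (if k < i then fps_X else 1) * fps_of_poly (refined_Eulerian d k))"
      by (auto simp: fps_of_poly_sum fps_of_poly_mult intro!: sum.cong)
    also have "\<dots> = (\<Sum>k\<le>d. (if k < i then fps_X else 1) * ((1 - fps_X) ^ Suc d * F d k))"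
      using Suc.IH by (auto simp: F_def intro!: sum.cong)
    finally show ?thesis by (simp only: sum_distrib_left ac_simps)
  qed
  ultimately show ?case by (simp add: F_def mult.assoc power_Suc2)
qed

lemma refined_Eulerian_nonneg: "coeff (refined_Eulerian d i) s \<ge> 0"
proof (induction d arbitrary: i s)
  case (Suc d)
  have "coeff ((if k < i then [:0, 1:] else 1) * refined_Eulerian d k) s \<ge> 0" for k
    using Suc by (auto simp: coeff_pCons split: nat.split)
  then show ?case by (auto simp: coeff_sum intro: sum_nonneg)
qed auto

lemma degree_refined_Eulerian: "degree (refined_Eulerian d i) \<le> d"
proof (induction d arbitrary: i)
  case (Suc d)
  have "degree ((if k < i then [:0, 1:] else 1) * refined_Eulerian d k) \<le> Suc d" for k
    using Suc[of k] degree_mult_le[of "[:0, 1:]" "refined_Eulerian d k"] by (auto simp: degree_pCons_eq_if)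
  then show ?case by (auto intro: degree_sum_le)
qed auto

lemma coeff_0_refined_Eulerian_0: "coeff (refined_Eulerian d 0) 0 \<ge> 1"
proof (induction d)
  case (Suc d)
  have "coeff (refined_Eulerian d 0) 0 \<le> (\<Sum>k\<le>d. coeff (refined_Eulerian d k) 0)"
    by (rule member_le_sum) (auto intro: refined_Eulerian_nonneg)
  with Suc show ?case by (simp add: coeff_sum)
qed auto

text \<open>After multiplication by \<open>x\<close>, passing to \<open>1 / x\<close> exchanges the
  factors \<open>1\<close> and \<open>x\<close> of the recursion; replacing \<open>k\<close> by
  \<open>d - k\<close> restores its form with the complementary index.\<close>

lemma refined_Eulerian_reciprocal:
  assumes "i \<le> d" "x \<noteq> 0"
  shows "x ^ d * poly (refined_Eulerian d i) (1 / x) = poly (refined_Eulerian d (d - i)) x"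
  using assms
proof (induction d arbitrary: i)
  case (Suc d)
  have "x ^ Suc d * poly (refined_Eulerian (Suc d) i) (1 / x) =
      (\<Sum>k\<le>d. (if k < i then 1 else x) * (x ^ d * poly (refined_Eulerian d k) (1 / x)))"
    unfolding refined_Eulerian.simps poly_sum sum_distrib_left
    using Suc.prems by (intro sum.cong) auto
  also have "\<dots> = (\<Sum>k\<le>d. (if k < i then 1 else x) * poly (refined_Eulerian d (d - k)) x)"
    using Suc by (intro sum.cong) auto
  also have "\<dots> = (\<Sum>k\<le>d. (if k < Suc d - i then x else 1) * poly (refined_Eulerian d k) x)"
    by (rule sum.reindex_bij_witness[of _ "\<lambda>k. d - k" "\<lambda>k. d - k"]) (use Suc.prems in auto)
  also have "\<dots> = poly (refined_Eulerian (Suc d) (Suc d - i)) x"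
    by (auto simp: poly_sum intro!: sum.cong)
  finally show ?case .
qed auto

section \<open>Interlacing values in the upper half-plane\<close>

text \<open>\<open>Im (w * cnj v) > 0\<close> says that the argument of \<open>w\<close> is ahead of
  that of \<open>v\<close> by an angle between 0 and pi. For \<open>z\<close> in the upper
  half-plane the arguments of the values thus increase with the index and stay within an angle
  \<open>arg z\<close>.\<close>

definition interlacing_values :: "complex \<Rightarrow> nat \<Rightarrow> (nat \<Rightarrow> complex) \<Rightarrow> bool" where
  "interlacing_values z d S \<longleftrightarrow>
     (\<forall>i\<le>d. S i \<noteq> 0) \<and>
     (\<forall>i j. i < j \<longrightarrow> j \<le> d \<longrightarrow> Im (S j * cnj (S i)) > 0) \<and>
     (\<forall>i j. i \<le> j \<longrightarrow> j \<le> d \<longrightarrow> Im (z * S i * cnj (S j)) \<ge> 0)"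

lemma Im_sum_mult_cnj_sum:
  "Im (c * (\<Sum>j\<in>B. f j) * cnj (\<Sum>i\<in>A. g i)) = (\<Sum>j\<in>B. \<Sum>i\<in>A. Im (c * f j * cnj (g i)))"
proof -
  have "c * (\<Sum>j\<in>B. f j) * cnj (\<Sum>i\<in>A. g i) = (\<Sum>j\<in>B. \<Sum>i\<in>A. c * f j * cnj (g i))"
    by (simp add: sum_distrib_left sum_distrib_right sum_product mult.assoc) (rule sum.swap)
  then show ?thesis by simp
qed

text \<open>Seen from the first summand with positive weight, every later one with positive weight
  lies strictly on the same side. If the sum vanished, only that first summand would be left, and it
  is nonzero.\<close>

lemma interlacing_weighted_sum_nonzero:
  assumes S: "interlacing_values z d S" and A: "A \<subseteq> {..d}"
    and s: "\<And>k. k \<in> A \<Longrightarrow> (s k :: real) \<ge> 0" and k: "k \<in> A" "s k > 0"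
  shows "(\<Sum>k\<in>A. of_real (s k) * S k) \<noteq> 0"
proof
  assume eq: "(\<Sum>k\<in>A. of_real (s k) * S k) = 0"
  have fin: "finite A" using A finite_subset by blast
  define i where "i = Min {k\<in>A. s k > 0}"
  have "i \<in> {k\<in>A. s k > 0}" unfolding i_def by (rule Min_in) (use fin k in auto)
  then have i: "i \<in> A" "s i > 0" by auto
  have imin: "s k = 0" if "k \<in> A" "k < i" for k
  proof (rule ccontr)
    assume "s k \<noteq> 0"
    with s[of k] that have "k \<in> {k\<in>A. s k > 0}" by auto
    then have "i \<le> k" unfolding i_def using fin by (intro Min_le) auto
    with that show False by simp
  qed
  have nn: "s k * Im (S k * cnj (S i)) \<ge> 0" if "k \<in> A" for k
  proof (cases k i rule: linorder_cases)
    case less then show ?thesis using imin that by simp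
  next
    case greater
    then have "Im (S k * cnj (S i)) > 0"
      using S that A unfolding interlacing_values_def by blast
    then show ?thesis using s[OF that] by (metis less_eq_real_def mult_nonneg_nonneg)
  qed (simp add: complex_mult_cnj)
  have "(\<Sum>k\<in>A. s k * Im (S k * cnj (S i))) = Im ((\<Sum>k\<in>A. of_real (s k) * S k) * cnj (S i))"
    unfolding sum_distrib_right mult.assoc Im_sum by simp
  also have "\<dots> = 0" by (simp add: eq)
  finally have z: "\<And>k. k \<in> A \<Longrightarrow> s k * Im (S k * cnj (S i)) = 0"
    using sum_nonneg_eq_0_iff[OF fin nn] by auto
  have "s k = 0" if "k \<in> A" "k \<noteq> i" for k
  proof (cases "k < i")
    case False
    then have "Im (S k * cnj (S i)) > 0"
      using S that A unfolding interlacing_values_def by (metis atMost_iff linorder_neqE_nat subsetD)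
    then show ?thesis using z[OF that(1)] by simp
  qed (use imin that in auto)
  then have "(\<Sum>k\<in>A. of_real (s k) * S k) = of_real (s i) * S i"
    using i fin by (subst sum.remove[of _ i]) auto
  moreover have "S i \<noteq> 0" using S i A unfolding interlacing_values_def by auto
  ultimately show False using eq i by simp
qed

text \<open>Inserting \<open>U = - (z * V)\<close> gives
  \<open>Im (U * cnj V) = - (Im z * (cmod V)\<^sup>2)\<close>, which forces \<open>V = 0\<close> and
  then \<open>U = 0\<close>.\<close>

lemma upper_half_plane_combination_nonzero:
  assumes z: "Im z > 0" and UV: "Im (U * cnj V) \<ge> 0" and "U \<noteq> 0 \<or> V \<noteq> 0"
  shows "U + z * V \<noteq> 0"
proof
  assume "U + z * V = 0"
  then have U: "U = - (z * V)" by (simp add: eq_neg_iff_add_eq_0)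
  have "Im (U * cnj V) = - (Im z * (cmod V)\<^sup>2)"
    unfolding U by (simp add: cmod_power2) algebra
  with UV z have "Im z * (cmod V)\<^sup>2 \<le> 0" by simp
  with z have "V = 0" by (simp add: mult_le_0_iff)
  with U assms show False by simp
qed

text \<open>Symmetrizing the double sum for \<open>Im (U * cnj V)\<close> in \<open>i\<close> and
  \<open>j\<close> produces the factors \<open>u j * v i - u i * v j\<close> and
  \<open>Im (S j * cnj (S i))\<close>. Both are nonnegative for \<open>i \<le> j\<close> and both
  change sign when \<open>i\<close> and \<open>j\<close> are exchanged.\<close>

lemma interlacing_monotone_weights_nonzero:
  assumes S: "interlacing_values z d S" and z: "Im z > 0"
    and u: "\<And>k. k \<le> d \<Longrightarrow> (u k :: real) > 0" "\<And>i j. i \<le> j \<Longrightarrow> j \<le> d \<Longrightarrow> u i \<le> u j"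
    and v: "\<And>k. k \<le> d \<Longrightarrow> (v k :: real) > 0" "\<And>i j. i \<le> j \<Longrightarrow> j \<le> d \<Longrightarrow> v j \<le> v i"
  shows "(\<Sum>k\<le>d. (of_real (u k) + z * of_real (v k)) * S k) \<noteq> 0"
proof -
  define U where "U = (\<Sum>k\<le>d. of_real (u k) * S k)"
  define V where "V = (\<Sum>k\<le>d. of_real (v k) * S k)"
  define g where "g j i = Im (S j * cnj (S i))" for i j
  have ganti: "g i j = - g j i" for i j by (simp add: g_def)
  have gpos: "g j i \<ge> 0" if "i \<le> j" "j \<le> d" for i j
    using S that unfolding interlacing_values_def g_def
    by (cases "i = j") (auto simp: order.order_iff_strict)
  have "Im (U * cnj V) = (\<Sum>j\<le>d. \<Sum>i\<le>d. u j * v i * g j i)"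
    using Im_sum_mult_cnj_sum[of 1 "\<lambda>k. of_real (u k) * S k" "{..d}" "\<lambda>k. of_real (v k) * S k" "{..d}"]
    unfolding U_def V_def g_def by (simp add: algebra_simps)
  moreover from this have "Im (U * cnj V) = (\<Sum>j\<le>d. \<Sum>i\<le>d. u i * v j * g i j)"
    by (subst sum.swap) simp
  ultimately have "2 * Im (U * cnj V) =
      (\<Sum>j\<le>d. \<Sum>i\<le>d. u j * v i * g j i) + (\<Sum>j\<le>d. \<Sum>i\<le>d. u i * v j * g i j)"
    by simp
  also have "\<dots> = (\<Sum>j\<le>d. \<Sum>i\<le>d. u j * v i * g j i + u i * v j * g i j)"
    by (simp only: sum.distrib)
  also have "\<dots> = (\<Sum>j\<le>d. \<Sum>i\<le>d. (u j * v i - u i * v j) * g j i)"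
  proof (intro sum.cong refl)
    fix i j
    show "u j * v i * g j i + u i * v j * g i j = (u j * v i - u i * v j) * g j i"
      using ganti[of i j] by (simp add: algebra_simps)
  qed
  also have "\<dots> \<ge> 0"
  proof (intro sum_nonneg)
    fix i j assume ij: "j \<in> {..d}" "i \<in> {..d}"
    have le: "u p * v q \<le> u q * v p" if "p \<le> q" "q \<le> d" for p q
      using that u(1)[of q] v(1)[of q] u(2)[of p q] v(2)[of p q] by (intro mult_mono) auto
    show "(u j * v i - u i * v j) * g j i \<ge> 0"
    proof (cases "i \<le> j")
      case True then show ?thesis using ij le[of i j] gpos[of i j] by auto
    next
      case False
      then show ?thesis using ij le[of j i] gpos[of j i] ganti[of j i] by (auto intro: mult_nonpos_nonneg)
    qed
  qed
  finally have "Im (U * cnj V) \<ge> 0" by simp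
  moreover have "U \<noteq> 0"
    unfolding U_def by (rule interlacing_weighted_sum_nonzero[OF S, of _ _ 0]) (use u in \<open>auto intro: less_imp_le\<close>)
  ultimately have "U + z * V \<noteq> 0"
    using z upper_half_plane_combination_nonzero by blast
  also have "U + z * V = (\<Sum>k\<le>d. (of_real (u k) + z * of_real (v k)) * S k)"
    by (simp add: U_def V_def sum_distrib_left sum.distrib algebra_simps)
  finally show ?thesis .
qed

text \<open>For \<open>i \<le> k\<close> let \<open>L\<close>, \<open>M\<close>, \<open>R\<close> be
  the sums of \<open>S\<close> over \<open>{..<i}\<close>, \<open>{i..<k}\<close>,
  \<open>{k..d}\<close>. Then \<open>S' i = z * L + M + R\<close> and
  \<open>S' k = z * L + z * M + R\<close>, and the imaginary parts in question expand into
  nonnegative terms.\<close>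

lemma interlacing_values_step:
  assumes S: "interlacing_values z d S" and z: "Im z > 0"
  defines "S' \<equiv> \<lambda>i. \<Sum>k\<le>d. (if k < i then z else 1) * S k"
  shows "interlacing_values z (Suc d) S'"
proof -
  have S0: "S i \<noteq> 0" if "i \<le> d" for i
    using S that unfolding interlacing_values_def by blast
  have S1: "Im (S j * cnj (S i)) > 0" if "i < j" "j \<le> d" for i j
    using S that unfolding interlacing_values_def by blast
  have S2: "Im (z * S i * cnj (S j)) \<ge> 0" if "i \<le> j" "j \<le> d" for i j
    using S that unfolding interlacing_values_def by blast
  define \<Sigma> where "\<Sigma> A = (\<Sum>k\<in>A. S k)" for A
  have le1: "Im (\<Sigma> B * cnj (\<Sigma> A)) \<ge> 0"
    if "\<And>i j. i \<in> A \<Longrightarrow> j \<in> B \<Longrightarrow> i < j \<and> j \<le> d" for A B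
    using Im_sum_mult_cnj_sum[of 1 S B S A] S1 that
    unfolding \<Sigma>_def mult_1 by (metis (no_types, lifting) sum_nonneg less_imp_le)
  have le2: "Im (z * \<Sigma> A * cnj (\<Sigma> B)) \<ge> 0"
    if "\<And>i j. i \<in> A \<Longrightarrow> j \<in> B \<Longrightarrow> i < j \<and> j \<le> d" for A B
    using Im_sum_mult_cnj_sum[of z S A S B] S2 that
    unfolding \<Sigma>_def mult_1 by (metis (no_types, lifting) sum_nonneg less_imp_le)
  have nz: "\<Sigma> A \<noteq> 0" if "A \<subseteq> {..d}" "k \<in> A" for A k
    using interlacing_weighted_sum_nonzero[OF S that(1), of "\<lambda>_. 1" k] that by (simp add: \<Sigma>_def)
  have S': "S' i = z * \<Sigma> {..<i} + \<Sigma> {i..d}" if "i \<le> Suc d" for i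
  proof -
    have "{..d} = {..<i} \<union> {i..d}" using that by auto
    then have "S' i = (\<Sum>k<i. (if k < i then z else 1) * S k) + (\<Sum>k\<in>{i..d}. (if k < i then z else 1) * S k)"
      unfolding S'_def by (simp add: sum.union_disjoint ivl_disj_int)
    also have "\<dots> = z * \<Sigma> {..<i} + \<Sigma> {i..d}"
      by (simp add: \<Sigma>_def sum_distrib_left)
    finally show ?thesis .
  qed
  have split1: "S' i = z * \<Sigma> {..<i} + \<Sigma> {i..<k} + \<Sigma> {k..d}"
   and split2: "S' k = z * \<Sigma> {..<i} + z * \<Sigma> {i..<k} + \<Sigma> {k..d}"
    if "i \<le> k" "k \<le> Suc d" for i k
  proof -
    have "\<Sigma> {i..d} = \<Sigma> {i..<k} + \<Sigma> {k..d}"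
      unfolding \<Sigma>_def using that
      by (subst sum.union_disjoint[symmetric]) (auto intro!: sum.cong)
    moreover have "\<Sigma> {..<k} = \<Sigma> {..<i} + \<Sigma> {i..<k}"
      unfolding \<Sigma>_def using that
      by (subst sum.union_disjoint[symmetric]) (auto intro!: sum.cong)
    ultimately show "S' i = z * \<Sigma> {..<i} + \<Sigma> {i..<k} + \<Sigma> {k..d}"
      "S' k = z * \<Sigma> {..<i} + z * \<Sigma> {i..<k} + \<Sigma> {k..d}"
      using that by (simp_all add: S' algebra_simps)
  qed
  \<comment> \<open>The term with \<open>(cmod M)\<^sup>2\<close> yields the strict inequality for
    \<open>i < k\<close>, where \<open>M\<close> is a nonempty sum and hence nonzero.\<close>
  have id1: "Im ((z * L + z * M + R) * cnj (z * L + M + R)) =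
     (cmod z)\<^sup>2 * Im (M * cnj L) + Im (z * L * cnj M) + Im z * (cmod M)\<^sup>2
       + Im (z * M * cnj R) + Im (R * cnj M)" for L M R
    by (simp add: cmod_power2) algebra
  have id2: "Im (z * (z * L + M + R) * cnj (z * L + z * M + R)) =
     Im z * (cmod (z * L + R))\<^sup>2 + (cmod z)\<^sup>2 * Im (z * L * cnj M) + (cmod z)\<^sup>2 * Im (M * cnj L)
       + Im (z * M * cnj R) + (cmod z)\<^sup>2 * Im (R * cnj M)" for L M R
    by (simp add: cmod_power2) algebra
  show ?thesis
    unfolding interlacing_values_def
  proof (intro conjI allI impI)
    fix i assume i: "i \<le> Suc d"
    have "Im (\<Sigma> {i..d} * cnj (\<Sigma> {..<i})) \<ge> 0" by (rule le1) auto
    moreover have "\<Sigma> {i..d} \<noteq> 0 \<or> \<Sigma> {..<i} \<noteq> 0"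
    proof (cases "i \<le> d")
      case True
      then show ?thesis using nz[of "{i..d}" i] by auto
    next
      case False
      have "{..<i} \<subseteq> {..d}" using i by auto
      with False show ?thesis using nz[of "{..<i}" 0] by auto
    qed
    ultimately show "S' i \<noteq> 0"
      using upper_half_plane_combination_nonzero[OF z] S'[OF i] by (metis add.commute)
  next
    fix i k assume ik: "i < k" "k \<le> Suc d"
    have "\<Sigma> {i..<k} \<noteq> 0" by (rule nz[of _ i]) (use ik in auto)
    then have "Im z * (cmod (\<Sigma> {i..<k}))\<^sup>2 > 0" using z by simp
    moreover have "(cmod z)\<^sup>2 * Im (\<Sigma> {i..<k} * cnj (\<Sigma> {..<i})) \<ge> 0"
      by (intro mult_nonneg_nonneg le1) (use ik in auto)
    moreover have "Im (z * \<Sigma> {..<i} * cnj (\<Sigma> {i..<k})) \<ge> 0" by (rule le2) (use ik in auto)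
    moreover have "Im (z * \<Sigma> {i..<k} * cnj (\<Sigma> {k..d})) \<ge> 0" by (rule le2) (use ik in auto)
    moreover have "Im (\<Sigma> {k..d} * cnj (\<Sigma> {i..<k})) \<ge> 0" by (rule le1) (use ik in auto)
    ultimately show "Im (S' k * cnj (S' i)) > 0"
      using split1[of i k] split2[of i k] id1 ik by simp
  next
    fix i k assume ik: "i \<le> k" "k \<le> Suc d"
    have "Im z * (cmod (z * \<Sigma> {..<i} + \<Sigma> {k..d}))\<^sup>2 \<ge> 0" using z by simp
    moreover have "(cmod z)\<^sup>2 * Im (\<Sigma> {i..<k} * cnj (\<Sigma> {..<i})) \<ge> 0"
      by (intro mult_nonneg_nonneg le1) (use ik in auto)
    moreover have "(cmod z)\<^sup>2 * Im (z * \<Sigma> {..<i} * cnj (\<Sigma> {i..<k})) \<ge> 0"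
      by (intro mult_nonneg_nonneg le2) (use ik in auto)
    moreover have "Im (z * \<Sigma> {i..<k} * cnj (\<Sigma> {k..d})) \<ge> 0" by (rule le2) (use ik in auto)
    moreover have "(cmod z)\<^sup>2 * Im (\<Sigma> {k..d} * cnj (\<Sigma> {i..<k})) \<ge> 0"
      by (intro mult_nonneg_nonneg le1) (use ik in auto)
    ultimately show "Im (z * S' i * cnj (S' k)) \<ge> 0"
      using split1[of i k] split2[of i k] id2 ik by simp
  qed
qed

section \<open>Real-rooted polynomials with nonnegative coefficients\<close>

text \<open>A nonnegative coefficient sequence with this property is log-concave without internal zeros.\<close>

definition PF2 :: "real poly \<Rightarrow> bool" where
  "PF2 p \<longleftrightarrow> (\<forall>i j. i \<le> j \<longrightarrow> coeff p i * coeff p (Suc j) \<le> coeff p (Suc i) * coeff p j)"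

lemma PF2_D: "PF2 p \<Longrightarrow> i \<le> j \<Longrightarrow> coeff p i * coeff p (Suc j) \<le> coeff p (Suc i) * coeff p j"
  by (simp add: PF2_def)

text \<open>The inequality is compared by powers of \<open>c\<close>. The constant and quadratic
  parts are instances of the hypothesis on \<open>p\<close>; the linear part needs
  \<open>f2\<close>, the same inequality with shift 2, which chains two instances.\<close>

lemma PF2_mult_linear:
  assumes p: "PF2 p" and nn: "\<And>i. coeff p i \<ge> 0" and c: "c \<ge> 0"
  shows "PF2 ([:c, 1:] * p)"
  unfolding PF2_def
proof (intro allI impI)
  fix i j :: nat assume ij: "i \<le> j"
  define f where "f = coeff p"
  have f: "f i * f (Suc j) \<le> f (Suc i) * f j" if "i \<le> j" for i j
    using PF2_D[OF p that] by (simp add: f_def)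
  have f2: "f i * f (Suc (Suc j)) \<le> f (Suc (Suc i)) * f j" if "i \<le> j" for i j
  proof (cases "i = j")
    case False
    then show ?thesis using f[of i "Suc j"] f[of "Suc i" j] that by linarith
  qed simp
  have h0: "coeff ([:c, 1:] * p) 0 = c * f 0" by (simp add: f_def)
  have hS: "coeff ([:c, 1:] * p) (Suc i) = f i + c * f (Suc i)" for i
    by (simp add: f_def)
  show "coeff ([:c, 1:] * p) i * coeff ([:c, 1:] * p) (Suc j)
      \<le> coeff ([:c, 1:] * p) (Suc i) * coeff ([:c, 1:] * p) j"
  proof (cases i)
    case 0
    show ?thesis
    proof (cases j)
      case 0
      with \<open>i = 0\<close> show ?thesis by simp
    next
      case (Suc J)
      have "0 \<le> f 0 * f J" using nn by (simp add: f_def)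
      moreover have "0 \<le> c * (f 1 * f J)" using nn c by (simp add: f_def)
      moreover have "c * c * (f 0 * f (Suc (Suc J))) \<le> c * c * (f 1 * f (Suc J))"
        using f[of 0 "Suc J"] c by (intro mult_left_mono) auto
      ultimately show ?thesis
        unfolding Suc \<open>i = 0\<close> h0 hS by (simp add: algebra_simps)
    qed
  next
    case (Suc I)
    with ij obtain J where J: "j = Suc J" "I \<le> J" by (cases j) auto
    have "c * (f I * f (Suc (Suc J))) \<le> c * (f (Suc (Suc I)) * f J)"
      using f2[OF J(2)] c by (intro mult_left_mono) auto
    moreover have "c * c * (f (Suc I) * f (Suc (Suc J))) \<le> c * c * (f (Suc (Suc I)) * f (Suc J))"
      using f[of "Suc I" "Suc J"] J c by (intro mult_left_mono) auto
    ultimately show ?thesis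
      unfolding Suc J hS using f[OF J(2)] by (simp add: algebra_simps)
  qed
qed

lemma PF2_imp_log_concave:
  assumes "PF2 p"
  shows "log_concave p"
  unfolding log_concave_def
proof (intro allI impI)
  fix i :: nat assume "i \<ge> 1"
  then show "(coeff p i)\<^sup>2 \<ge> coeff p (i - 1) * coeff p (i + 1)"
    using PF2_D[OF assms, of "i - 1" i] by (simp add: power2_eq_square)
qed

text \<open>The ratios of consecutive coefficients decrease, so after a ratio below 1 none exceeds
  1. The argument is kept free of division because coefficients may vanish.\<close>

lemma PF2_decreasing:
  assumes p: "PF2 p" and nn: "\<And>i. coeff p i \<ge> 0"
    and dec: "coeff p (Suc i) < coeff p i" and ij: "i \<le> j"
  shows "coeff p (Suc j) \<le> coeff p j"
proof (rule ccontr)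
  assume a: "\<not> coeff p (Suc j) \<le> coeff p j"
  then have "coeff p (Suc j) > 0" using nn[of j] by linarith
  with dec have "coeff p (Suc i) * coeff p (Suc j) < coeff p i * coeff p (Suc j)" by simp
  moreover have "coeff p (Suc i) * coeff p j \<le> coeff p (Suc i) * coeff p (Suc j)"
    using a nn by (intro mult_left_mono) auto
  ultimately show False using PF2_D[OF p ij] by linarith
qed

lemma lead_coeff_pos_of_nonneg_coeffs:
  fixes p :: "real poly"
  assumes "p \<noteq> 0" "\<And>i. coeff p i \<ge> 0"
  shows "lead_coeff p > 0"
  using assms(2)[of "degree p"] leading_coeff_neq_0[OF assms(1)] by linarith

lemma PF2_imp_unimodal:
  assumes p: "PF2 p" and nn: "\<And>i. coeff p i \<ge> 0"
  shows "unimodal p"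
proof (cases "p = 0")
  case True
  then show ?thesis by (auto simp: unimodal_def)
next
  case False
  \<comment> \<open>The mode is the place of the first strict decrease; one occurs at the latest at
    the degree, where the next coefficient is zero.\<close>
  define s where "s = (LEAST i. coeff p (Suc i) < coeff p i)"
  have "coeff p (Suc (degree p)) < coeff p (degree p)"
    using lead_coeff_pos_of_nonneg_coeffs[OF False nn] by (simp add: coeff_eq_0)
  then have s: "coeff p (Suc s) < coeff p s" "s \<le> degree p"
    unfolding s_def by (rule LeastI, rule Least_le)
  show ?thesis
    unfolding unimodal_def
  proof (intro exI[of _ s] conjI allI impI ballI)
    fix i assume "i < s"
    then show "coeff p i \<le> coeff p (i + 1)"
      using not_less_Least[of i "\<lambda>i. coeff p (Suc i) < coeff p i"] by (simp add: s_def)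
  next
    fix i assume "i \<in> {s..<degree p}"
    then show "coeff p (i + 1) \<le> coeff p i"
      using PF2_decreasing[OF p nn s(1), of i] by simp
  qed (use s in auto)
qed

lemma symmetric_wrt_coeff: "symmetric_wrt N p \<Longrightarrow> s \<le> N \<Longrightarrow> coeff p s = coeff p (N - s)"
  unfolding symmetric_wrt_def by blast

text \<open>A strict decrease in the first half would persist as a weak decrease at the mirror
  position, where symmetry demands a strict increase.\<close>

lemma PF2_symmetric_increasing:
  assumes p: "PF2 p" and nn: "\<And>i. coeff p i \<ge> 0" and sym: "symmetric_wrt N p"
    and i: "2 * i + 1 \<le> N"
  shows "coeff p i \<le> coeff p (Suc i)"
proof (rule ccontr)
  assume a: "\<not> coeff p i \<le> coeff p (Suc i)"
  then have "coeff p (Suc (N - Suc i)) \<le> coeff p (N - Suc i)"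
    using PF2_decreasing[OF p nn, of i "N - Suc i"] i by linarith
  moreover have "coeff p (Suc i) = coeff p (N - Suc i)" "coeff p i = coeff p (N - i)"
    by (rule symmetric_wrt_coeff[OF sym], use i in simp)+
  moreover have "Suc (N - Suc i) = N - i" using i by simp
  ultimately show False using a by simp
qed

section \<open>Real polynomials at complex points\<close>

abbreviation cpoly :: "real poly \<Rightarrow> complex \<Rightarrow> complex" where
  "cpoly p z \<equiv> poly (map_poly of_real p) z"

lemma cpoly_pCons: "cpoly (pCons a p) z = of_real a + z * cpoly p z"
  by (cases "a = 0 \<and> p = 0") (auto simp: map_poly_pCons)

lemma cpoly_add: "cpoly (p + q) z = cpoly p z + cpoly q z"
  by (induction p q rule: poly_induct2) (simp_all add: cpoly_pCons algebra_simps)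

lemma cpoly_smult: "cpoly (smult c p) z = of_real c * cpoly p z"
  by (induction p) (simp_all add: cpoly_pCons algebra_simps)

lemma cpoly_mult: "cpoly (p * q) z = cpoly p z * cpoly q z"
  by (induction p) (simp_all add: cpoly_pCons cpoly_add cpoly_smult algebra_simps)

lemma cpoly_sum: "cpoly (\<Sum>k\<in>A. f k) z = (\<Sum>k\<in>A. cpoly (f k) z)"
  by (induction A rule: infinite_finite_induct) (simp_all add: cpoly_add)

lemma cpoly_of_real: "cpoly p (of_real x) = of_real (poly p x)"
  by (induction p) (simp_all add: cpoly_pCons)

lemma cpoly_cnj: "cpoly p (cnj z) = cnj (cpoly p z)"
  by (induction p) (simp_all add: cpoly_pCons)

text \<open>Nonreal roots come in conjugate pairs, and one of each pair lies in the upper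
  half-plane.\<close>

lemma real_rooted_upper_half_planeI:
  assumes "\<And>z. Im z > 0 \<Longrightarrow> cpoly p z \<noteq> 0"
  shows "real_rooted p"
proof -
  have "z \<in> \<real>" if "cpoly p z = 0" for z
  proof (cases "Im z" "0::real" rule: linorder_cases)
    case less
    then show ?thesis using assms[of "cnj z"] that by (simp add: cpoly_cnj)
  next
    case greater
    then show ?thesis using assms[of z] that by simp
  qed (auto simp: complex_is_Real_iff)
  then show ?thesis by (auto simp: real_rooted_def)
qed

section \<open>Factorization of polynomials with nonpositive roots\<close>

definition nonpos_rooted :: "real poly \<Rightarrow> bool" where
  "nonpos_rooted p \<longleftrightarrow> lead_coeff p > 0 \<and> (\<forall>z. cpoly p z = 0 \<longrightarrow> z \<in> \<real> \<and> Re z \<le> 0)"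

lemma nonpos_rooted_factor:
  assumes "nonpos_rooted (p * q)" "lead_coeff p > 0"
  shows "nonpos_rooted q"
  using assms unfolding nonpos_rooted_def cpoly_mult lead_coeff_mult by (auto simp: zero_less_mult_iff)

lemma poly_pos_of_nonneg_coeffs:
  assumes "p \<noteq> 0" "\<And>i. coeff p i \<ge> 0" "x > (0::real)"
  shows "poly p x > 0"
proof -
  have "coeff p (degree p) * x ^ degree p \<le> poly p x"
    unfolding poly_altdef by (rule member_le_sum) (use assms in auto)
  moreover have "coeff p (degree p) * x ^ degree p > 0"
    using lead_coeff_pos_of_nonneg_coeffs[OF assms(1,2)] assms(3) by simp
  ultimately show ?thesis by linarith
qed

lemma nonpos_rootedI:
  assumes rr: "real_rooted p" and "p \<noteq> 0" and nn: "\<And>i. coeff p i \<ge> 0"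
  shows "nonpos_rooted p"
  unfolding nonpos_rooted_def
proof (intro conjI allI impI)
  show "lead_coeff p > 0" by (rule lead_coeff_pos_of_nonneg_coeffs) fact+
  fix z assume z: "cpoly p z = 0"
  have "degree p \<noteq> 0"
  proof
    assume "degree p = 0"
    then obtain c where "p = [:c:]" by (rule degree_eq_zeroE)
    with z \<open>p \<noteq> 0\<close> show False by (simp add: cpoly_pCons)
  qed
  then show "z \<in> \<real>" using rr z by (auto simp: real_rooted_def)
  then obtain x where "z = of_real x" by (elim Reals_cases)
  with z show "Re z \<le> 0"
    using poly_pos_of_nonneg_coeffs[OF \<open>p \<noteq> 0\<close> nn, of x] by (cases "x > 0") (auto simp: cpoly_of_real)
qed

lemma nonpos_rooted_root:
  assumes "nonpos_rooted p" "degree p > 0"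
  obtains c where "c \<ge> 0" "poly p (- c) = 0"
proof -
  have "degree (map_poly complex_of_real p) = degree p"
    by (rule degree_map_poly) auto
  then have "\<not> constant (poly (map_poly complex_of_real p))"
    using assms by (simp add: constant_degree)
  then obtain z where z: "cpoly p z = 0" using fundamental_theorem_of_algebra by blast
  with assms have "z \<in> \<real>" "Re z \<le> 0" by (auto simp: nonpos_rooted_def)
  then obtain x where "z = of_real x" "x \<le> 0" by (auto elim!: Reals_cases)
  with z that[of "- x"] show ?thesis by (simp add: cpoly_of_real)
qed

text \<open>The fundamental theorem of algebra and the condition on roots provide a factor
  \<open>x + c\<close> with \<open>c \<ge> 0\<close>, and the cofactor inherits the hypothesis.
  Properties can thus be proved one linear factor at a time.\<close>

lemma nonpos_rooted_induct [consumes 1, case_names const linear]: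
  assumes "nonpos_rooted p"
    and "\<And>c. c > 0 \<Longrightarrow> Q [:c:]"
    and step: "\<And>c q. c \<ge> 0 \<Longrightarrow> nonpos_rooted q \<Longrightarrow> Q q \<Longrightarrow> Q ([:c, 1:] * q)"
  shows "Q p"
  using assms(1)
proof (induction "degree p" arbitrary: p rule: less_induct)
  case less
  show ?case
  proof (cases "degree p = 0")
    case True
    then obtain c where "p = [:c:]" by (rule degree_eq_zeroE)
    with less.prems show ?thesis by (auto simp: nonpos_rooted_def intro: assms(2))
  next
    case False
    then obtain c where c: "c \<ge> 0" "poly p (- c) = 0"
      using nonpos_rooted_root less.prems by blast
    then obtain q where q: "p = [:c, 1:] * q" by (auto simp: poly_eq_0_iff_dvd elim: dvdE)
    then have nq: "nonpos_rooted q" using nonpos_rooted_factor less.prems by fastforce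
    moreover have "q \<noteq> 0" using nq by (auto simp: nonpos_rooted_def)
    then have "degree q < degree p" unfolding q by (subst degree_mult_eq) auto
    ultimately show ?thesis using less.hyps c(1) step by (simp add: q)
  qed
qed

lemma nonpos_rooted_nonneg_PF2:
  assumes "nonpos_rooted p"
  shows "(\<forall>i. coeff p i \<ge> 0) \<and> PF2 p"
  using assms
proof (induction rule: nonpos_rooted_induct)
  case (const c)
  then show ?case by (auto simp: PF2_def coeff_pCons split: nat.split)
next
  case (linear c q)
  then have "coeff ([:c, 1:] * q) i \<ge> 0" for i by (cases i) auto
  moreover have "PF2 ([:c, 1:] * q)" using linear by (intro PF2_mult_linear) auto
  ultimately show ?case by blast
qed

lemma real_rooted_nonneg_imp_PF2:
  assumes "real_rooted p" "\<And>i. coeff p i \<ge> 0"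
  shows "PF2 p"
proof (cases "p = 0")
  case False
  then show ?thesis using nonpos_rooted_nonneg_PF2 nonpos_rootedI assms by blast
qed (simp add: PF2_def)

section \<open>Symmetry as a functional equation\<close>

lemma symmetric_wrt_reciprocal:
  assumes sym: "symmetric_wrt N p" and "x \<noteq> 0"
  shows "x ^ N * poly p (1 / x) = poly p x"
proof -
  have deg: "degree p \<le> N" using sym by (simp add: symmetric_wrt_def)
  have ev: "poly p y = (\<Sum>s\<le>N. coeff p s * y ^ s)" for y
    using arg_cong[OF poly_as_sum_of_monoms'[OF deg], of "\<lambda>q. poly q y"]
    by (simp add: poly_sum poly_monom)
  have "x ^ N * poly p (1 / x) = (\<Sum>s\<le>N. coeff p s * x ^ (N - s))"
    unfolding ev using \<open>x \<noteq> 0\<close>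
    by (auto simp: sum_distrib_left power_diff field_simps intro!: sum.cong)
  also have "\<dots> = (\<Sum>s\<le>N. coeff p (N - s) * x ^ s)"
    by (rule sum.reindex_bij_witness[of _ "\<lambda>s. N - s" "\<lambda>s. N - s"]) auto
  also have "\<dots> = poly p x"
    unfolding ev by (intro sum.cong refl arg_cong2[of _ _ _ _ times] symmetric_wrt_coeff[OF sym, symmetric]) simp
  finally show ?thesis .
qed

lemma poly_eq_on_pos:
  fixes p q :: "real poly"
  assumes "\<And>x. x > 0 \<Longrightarrow> poly p x = poly q x"
  shows "p = q"
proof (rule ccontr)
  assume "p \<noteq> q"
  then have "finite {x. poly (p - q) x = 0}" by (intro poly_roots_finite) simp
  then have "finite {0::real<..}" by (rule rev_finite_subset) (use assms in auto)
  then show False using infinite_Ioi by blast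
qed

text \<open>The functional equation identifies \<open>p\<close> with its reversal at all positive
  \<open>x\<close>, and infinitely many values determine a polynomial.\<close>

lemma symmetric_wrtI:
  assumes deg: "degree p \<le> N" and eq: "\<And>x. x > 0 \<Longrightarrow> x ^ N * poly p (1 / x) = poly p x"
  shows "symmetric_wrt N p"
proof -
  define q where "q = (\<Sum>s\<le>N. monom (coeff p (N - s)) s)"
  have cq: "coeff q s = (if s \<le> N then coeff p (N - s) else 0)" for s
    by (simp add: q_def coeff_sum)
  have ev: "poly p y = (\<Sum>s\<le>N. coeff p s * y ^ s)" for y
    using arg_cong[OF poly_as_sum_of_monoms'[OF deg], of "\<lambda>q. poly q y"]
    by (simp add: poly_sum poly_monom)
  have "p = q"
  proof (rule poly_eq_on_pos)
    fix x :: real assume x: "x > 0"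
    have "poly p x = x ^ N * poly p (1 / x)" using eq x by simp
    also have "\<dots> = (\<Sum>s\<le>N. coeff p s * x ^ (N - s))"
      unfolding ev using x
      by (auto simp: sum_distrib_left power_diff field_simps intro!: sum.cong)
    also have "\<dots> = (\<Sum>s\<le>N. coeff p (N - s) * x ^ s)"
      by (rule sum.reindex_bij_witness[of _ "\<lambda>s. N - s" "\<lambda>s. N - s"]) auto
    finally show "poly p x = poly q x" by (simp add: q_def poly_sum poly_monom)
  qed
  then have "coeff p s = coeff p (N - s)" if "s \<le> N" for s using cq[of s] that by simp
  with deg show ?thesis unfolding symmetric_wrt_def by blast
qed

text \<open>The functional equation of \<open>p * q\<close> can be divided by that of
  \<open>p\<close> at every positive point.\<close>

lemma symmetric_wrt_cancel:
  assumes pq: "symmetric_wrt (K + N) (p * q)" and p: "symmetric_wrt K p"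
    and pos: "\<And>x. x > 0 \<Longrightarrow> poly p x \<noteq> 0" and deg: "degree q \<le> N"
  shows "symmetric_wrt N q"
proof (rule symmetric_wrtI[OF deg])
  fix x :: real assume x: "x > 0"
  have "poly p x * (x ^ N * poly q (1 / x)) = x ^ (K + N) * poly (p * q) (1 / x)"
    using symmetric_wrt_reciprocal[OF p, of x] x by (simp add: power_add)
  also have "\<dots> = poly p x * poly q x"
    using symmetric_wrt_reciprocal[OF pq, of x] x by simp
  finally show "x ^ N * poly q (1 / x) = poly q x" using pos[OF x] by simp
qed

section \<open>The cone of gamma-positive expansions\<close>

text \<open>The expansion condition of \<open>gamma_positive\<close> is separated from symmetry, so
  that closure under sums and products can be shown for it alone.\<close>

definition gamma_cone :: "nat \<Rightarrow> real poly set" where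
  "gamma_cone N = {p. \<exists>\<gamma>::nat \<Rightarrow> real. (\<forall>i\<le>N div 2. \<gamma> i \<ge> 0) \<and>
     p = (\<Sum>i\<le>N div 2. smult (\<gamma> i) ([:0, 1:] ^ i * [:1, 1:] ^ (N - 2 * i)))}"

lemma gamma_cone_basis:
  assumes "c \<ge> 0" "i \<le> N div 2"
  shows "smult c ([:0, 1:] ^ i * [:1, 1:] ^ (N - 2 * i)) \<in> gamma_cone N"
proof -
  have "(\<Sum>j\<le>N div 2. smult (if j = i then c else 0) ([:0, 1:] ^ j * [:1, 1:] ^ (N - 2 * j))) =
      (\<Sum>j\<le>N div 2. if j = i then smult c ([:0, 1:] ^ j * [:1, 1:] ^ (N - 2 * j)) else 0)"
    by (intro sum.cong) auto
  also have "\<dots> = smult c ([:0, 1:] ^ i * [:1, 1:] ^ (N - 2 * i))" using assms by simp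
  finally have "smult c ([:0, 1:] ^ i * [:1, 1:] ^ (N - 2 * i)) =
      (\<Sum>j\<le>N div 2. smult (if j = i then c else 0) ([:0, 1:] ^ j * [:1, 1:] ^ (N - 2 * j)))" ..
  then show ?thesis
    unfolding gamma_cone_def mem_Collect_eq using assms(1)
    by (intro exI[of _ "\<lambda>j. if j = i then c else 0"]) auto
qed

lemma gamma_cone_add:
  assumes "p \<in> gamma_cone N" "q \<in> gamma_cone N"
  shows "p + q \<in> gamma_cone N"
proof -
  obtain \<gamma> \<delta> where "\<forall>i\<le>N div 2. \<gamma> i \<ge> 0" "\<forall>i\<le>N div 2. \<delta> i \<ge> 0"
    "p = (\<Sum>i\<le>N div 2. smult (\<gamma> i) ([:0, 1:] ^ i * [:1, 1:] ^ (N - 2 * i)))"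
    "q = (\<Sum>i\<le>N div 2. smult (\<delta> i) ([:0, 1:] ^ i * [:1, 1:] ^ (N - 2 * i)))"
    using assms unfolding gamma_cone_def by blast
  then show ?thesis
    unfolding gamma_cone_def
    by (intro CollectI exI[of _ "\<lambda>i. \<gamma> i + \<delta> i"]) (simp add: smult_add_left sum.distrib)
qed

lemma gamma_cone_sum:
  assumes "\<And>i. i \<in> I \<Longrightarrow> f i \<in> gamma_cone N"
  shows "(\<Sum>i\<in>I. f i) \<in> gamma_cone N"
proof -
  have "0 \<in> gamma_cone N" using gamma_cone_basis[of 0 0 N] by simp
  then show ?thesis
    using assms by (induction I rule: infinite_finite_induct) (auto intro: gamma_cone_add)
qed

text \<open>The product of the basis elements with indices \<open>i\<close> and \<open>j\<close> is
  the basis element with index \<open>i + j\<close> for \<open>N + K\<close>.\<close>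

lemma gamma_cone_mult:
  assumes "p \<in> gamma_cone N" "q \<in> gamma_cone K"
  shows "p * q \<in> gamma_cone (N + K)"
proof -
  obtain \<gamma> \<delta> where nn: "\<forall>i\<le>N div 2. \<gamma> i \<ge> 0" "\<forall>i\<le>K div 2. \<delta> i \<ge> 0"
    and pq: "p = (\<Sum>i\<le>N div 2. smult (\<gamma> i) ([:0, 1:] ^ i * [:1, 1:] ^ (N - 2 * i)))"
    "q = (\<Sum>i\<le>K div 2. smult (\<delta> i) ([:0, 1:] ^ i * [:1, 1:] ^ (K - 2 * i)))"
    using assms unfolding gamma_cone_def by blast
  show ?thesis
    unfolding pq sum_product
  proof (intro gamma_cone_sum)
    fix i j assume ij: "i \<in> {..N div 2}" "j \<in> {..K div 2}"
    have "(N + K) - 2 * (i + j) = (N - 2 * i) + (K - 2 * j)" using ij by auto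
    then have eq: "smult (\<gamma> i) ([:0, 1:] ^ i * [:1, 1:] ^ (N - 2 * i)) *
        smult (\<delta> j) ([:0, 1:] ^ j * [:1, 1:] ^ (K - 2 * j)) =
        smult (\<gamma> i * \<delta> j) ([:0, 1:] ^ (i + j) * [:1, 1:] ^ (N + K - 2 * (i + j)))"
      by (simp only: power_add mult_smult_left mult_smult_right smult_smult ac_simps)
    show "smult (\<gamma> i) ([:0, 1:] ^ i * [:1, 1:] ^ (N - 2 * i)) *
        smult (\<delta> j) ([:0, 1:] ^ j * [:1, 1:] ^ (K - 2 * j)) \<in> gamma_cone (N + K)"
      unfolding eq by (rule gamma_cone_basis) (use ij nn in auto)
  qed
qed

text \<open>The nonzero roots of a symmetric polynomial come in pairs \<open>-c\<close>, \<open>-1/c\<close>, and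
  \<open>(x + c) (x + 1/c) = (1 + x)\<^sup>2 + (c + 1/c - 2) x\<close> with \<open>c + 1/c \<ge> 2\<close>.\<close>

lemma nonpos_rooted_symmetric_in_gamma_cone:
  assumes "nonpos_rooted p" "symmetric_wrt N p"
  shows "p \<in> gamma_cone N"
  using assms
proof (induction N arbitrary: p rule: less_induct)
  case (less N)
  note rooted = less.prems(1) and sym = less.prems(2)
  have deg: "degree p \<le> N" using sym by (simp add: symmetric_wrt_def)
  have "p \<noteq> 0" using rooted by (auto simp: nonpos_rooted_def)
  \<comment> \<open>Splitting off a symmetric factor from the cone leaves a symmetric cofactor, to
    which the induction hypothesis applies.\<close>
  have factor: "p \<in> gamma_cone N"
    if eq: "p = f * q" and f: "symmetric_wrt K f" "f \<in> gamma_cone K" "lead_coeff f > 0" "K > 0"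
      and nz: "\<And>x. x > 0 \<Longrightarrow> poly f x \<noteq> 0" and q: "degree q + K \<le> N" for f q K
  proof -
    have KN: "K + (N - K) = N" using q by simp
    have "symmetric_wrt (N - K) q"
      using symmetric_wrt_cancel[of K "N - K" f q] sym f nz q KN eq by simp
    moreover have "nonpos_rooted q" using nonpos_rooted_factor rooted eq f by blast
    ultimately have "q \<in> gamma_cone (N - K)" using less.IH[of "N - K" q] f q by simp
    then show ?thesis using gamma_cone_mult[OF f(2)] KN eq by metis
  qed
  have top: "coeff p N = coeff p 0" using symmetric_wrt_coeff[OF sym, of 0] by simp
  show ?case
  proof (cases "coeff p 0 = 0")
    case True
    then have "poly p 0 = 0" by (simp add: poly_0_coeff_0)
    then obtain q where q: "p = [:0, 1:] * q" by (auto simp: poly_eq_0_iff_dvd elim: dvdE)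
    then have "q \<noteq> 0" using \<open>p \<noteq> 0\<close> by auto
    then have dp: "degree p = Suc (degree q)" by (simp add: q)
    \<comment> \<open>By symmetry a root at 0 also removes the coefficient of index
      \<open>N\<close>. This leaves room for the factor \<open>x\<close>, which is symmetric with
      respect to 2.\<close>
    have "degree p \<noteq> N" using top True leading_coeff_neq_0[OF \<open>p \<noteq> 0\<close>] by auto
    with dp deg have "degree q + 2 \<le> N" by simp
    moreover have "symmetric_wrt 2 [:0, 1:]"
      by (rule symmetric_wrtI) (auto simp: power2_eq_square)
    moreover have "[:0, 1:] \<in> gamma_cone 2" using gamma_cone_basis[of 1 1 2] by simp
    ultimately show ?thesis by (intro factor[OF q, of 2]) auto
  next
    case nz: False
    then have degN: "degree p = N" using top deg by (metis le_degree le_antisym)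
    show ?thesis
    proof (cases "N = 0")
      case True
      with degN obtain c where c: "p = [:c:]" by (auto elim: degree_eq_zeroE)
      with rooted have "c > 0" by (auto simp: nonpos_rooted_def)
      then show ?thesis using gamma_cone_basis[of c 0 0] by (simp add: c True)
    next
      case False
      then obtain c where c: "c \<ge> 0" "poly p (- c) = 0"
        using nonpos_rooted_root[OF rooted] degN by auto
      then have "c \<noteq> 0" using nz by (auto simp: poly_0_coeff_0)
      from c obtain q where q: "p = [:c, 1:] * q" by (auto simp: poly_eq_0_iff_dvd elim: dvdE)
      then have "q \<noteq> 0" using \<open>p \<noteq> 0\<close> by auto
      then have dp: "degree p = Suc (degree q)" unfolding q by (subst degree_mult_eq) auto
      show ?thesis
      proof (cases "c = 1")
        case True
        \<comment> \<open>The root \<open>-1\<close> is its own partner, so \<open>1 + x\<close> is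
          split off alone.\<close>
        have "symmetric_wrt 1 [:1, 1:]"
          by (rule symmetric_wrtI) (auto simp: field_simps)
        moreover have "[:1, 1:] \<in> gamma_cone 1" using gamma_cone_basis[of 1 0 1] by simp
        ultimately show ?thesis
          using q True dp degN by (intro factor[of "[:1, 1:]" q 1]) auto
      next
        case False
        have "poly p (- (1 / c)) = 0"
          using symmetric_wrt_reciprocal[OF sym, of "- c"] c \<open>c \<noteq> 0\<close> by simp
        \<comment> \<open>The partner root \<open>-1/c\<close> differs from \<open>-c\<close>, so it
          must be a root of the cofactor \<open>q\<close>.\<close>
        moreover have "c - 1 / c \<noteq> 0"
        proof
          assume "c - 1 / c = 0"
          then have "c * c = 1" using \<open>c \<noteq> 0\<close> by (simp add: field_simps)
          with c False show False by (simp add: square_eq_1_iff)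
        qed
        moreover have "poly p (- (1 / c)) = (c - 1 / c) * poly q (- (1 / c))"
          unfolding q by (simp add: algebra_simps)
        ultimately have "poly q (- (1 / c)) = 0" by simp
        then obtain q' where q': "q = [:1 / c, 1:] * q'"
          by (auto simp: poly_eq_0_iff_dvd elim: dvdE)
        then have "q' \<noteq> 0" using \<open>q \<noteq> 0\<close> by auto
        then have dq: "degree q = Suc (degree q')" unfolding q' by (subst degree_mult_eq) auto
        define f where "f = [:1, c + 1 / c, 1:]"
        have eq: "p = f * q'"
          unfolding q q' f_def mult.assoc[symmetric] using \<open>c \<noteq> 0\<close> by (simp add: add.commute)
        have "symmetric_wrt 2 f"
          unfolding f_def by (rule symmetric_wrtI) (auto simp: field_simps power2_eq_square)
        moreover have "f \<in> gamma_cone 2"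
        proof -
          have "(c - 1)\<^sup>2 / c \<ge> 0" using c by simp
          also have "(c - 1)\<^sup>2 / c = c + 1 / c - 2"
            using \<open>c \<noteq> 0\<close> by (simp add: field_simps power2_eq_square)
          finally have "smult (c + 1 / c - 2) ([:0, 1:] ^ 1 * [:1, 1:] ^ (2 - 2 * 1)) \<in> gamma_cone 2"
            by (intro gamma_cone_basis) auto
          moreover have "smult 1 ([:0, 1:] ^ 0 * [:1, 1:] ^ (2 - 2 * 0)) \<in> gamma_cone 2"
            by (intro gamma_cone_basis) auto
          ultimately have "smult (c + 1 / c - 2) ([:0, 1:] ^ 1 * [:1, 1:] ^ (2 - 2 * 1))
              + smult 1 ([:0, 1:] ^ 0 * [:1, 1:] ^ (2 - 2 * 0)) \<in> gamma_cone 2"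
            by (rule gamma_cone_add)
          then show ?thesis by (simp add: f_def power2_eq_square)
        qed
        moreover have "poly f x \<noteq> 0" if "x > 0" for x
        proof -
          have "poly f x = 1 + (c + 1 / c) * x + x * x" by (simp add: f_def algebra_simps)
          moreover have "(c + 1 / c) * x \<ge> 0" "x * x > 0" using c that by auto
          ultimately show ?thesis by linarith
        qed
        ultimately show ?thesis
          using dp dq degN by (intro factor[OF eq, of 2]) (auto simp: f_def)
      qed
    qed
  qed
qed

lemma real_rooted_symmetric_imp_gamma_positive:
  assumes "real_rooted p" "\<And>i. coeff p i \<ge> 0" "symmetric_wrt N p"
  shows "gamma_positive N p"
proof -
  have "p \<in> gamma_cone N"
  proof (cases "p = 0")
    case True
    then show ?thesis using gamma_cone_basis[of 0 0 N] by simp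
  next
    case False
    then show ?thesis
      using nonpos_rooted_symmetric_in_gamma_cone nonpos_rootedI assms by blast
  qed
  then show ?thesis using assms(3) by (simp add: gamma_positive_def gamma_cone_def)
qed

section \<open>Combinations of refined Eulerian polynomials\<close>

lemma cpoly_refined_Eulerian_Suc:
  "cpoly (refined_Eulerian (Suc d) i) z =
    (\<Sum>k\<le>d. (if k < i then z else 1) * cpoly (refined_Eulerian d k) z)"
  by (auto simp: cpoly_sum cpoly_mult cpoly_pCons intro!: sum.cong)

lemma refined_Eulerian_interlacing_values:
  assumes "Im z > 0"
  shows "interlacing_values z d (\<lambda>i. cpoly (refined_Eulerian d i) z)"
proof (induction d)
  case 0
  then show ?case using assms by (auto simp: interlacing_values_def)
next
  case (Suc d)
  show ?case
    unfolding cpoly_refined_Eulerian_Suc by (rule interlacing_values_step[OF Suc assms])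
qed

lemma real_rooted_monotone_weights:
  assumes u: "\<And>k. k \<le> d \<Longrightarrow> u k > 0" "\<And>i j. i \<le> j \<Longrightarrow> j \<le> d \<Longrightarrow> u i \<le> u j"
    and v: "\<And>k. k \<le> d \<Longrightarrow> v k > 0" "\<And>i j. i \<le> j \<Longrightarrow> j \<le> d \<Longrightarrow> v j \<le> v i"
  shows "real_rooted (\<Sum>k\<le>d. [:u k, v k:] * refined_Eulerian d k)"
proof (rule real_rooted_upper_half_planeI)
  fix z assume z: "Im z > 0"
  have "cpoly (\<Sum>k\<le>d. [:u k, v k:] * refined_Eulerian d k) z =
      (\<Sum>k\<le>d. (of_real (u k) + z * of_real (v k)) * cpoly (refined_Eulerian d k) z)"
    by (simp only: cpoly_sum cpoly_mult cpoly_pCons) simp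
  also have "\<dots> \<noteq> 0"
    by (rule interlacing_monotone_weights_nonzero[OF refined_Eulerian_interlacing_values[OF z] z u v])
  finally show "cpoly (\<Sum>k\<le>d. [:u k, v k:] * refined_Eulerian d k) z \<noteq> 0" .
qed

lemma real_rooted_nonneg_weights:
  assumes s: "\<And>k. k \<le> d \<Longrightarrow> s k \<ge> 0"
  shows "real_rooted (\<Sum>k\<le>d. smult (s k) (refined_Eulerian d k))"
proof (cases "\<exists>k\<le>d. s k > 0")
  case True
  then obtain k where k: "k \<le> d" "s k > 0" by blast
  show ?thesis
  proof (rule real_rooted_upper_half_planeI)
    fix z assume z: "Im z > 0"
    show "cpoly (\<Sum>k\<le>d. smult (s k) (refined_Eulerian d k)) z \<noteq> 0"
      unfolding cpoly_sum cpoly_smult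
      by (rule interlacing_weighted_sum_nonzero[OF refined_Eulerian_interlacing_values[OF z], where k = k])
        (use k s in auto)
  qed
next
  case False
  then have "s k = 0" if "k \<le> d" for k using s[OF that] that by force
  then show ?thesis by (simp add: real_rooted_def)
qed

text \<open>Coefficient \<open>i\<close> of \<open>p\<close> is
  \<open>coeff a i + coeff b (i - 1)\<close>, and by symmetry coefficient \<open>Suc e - i\<close>
  is \<open>coeff a i + coeff b i\<close>. The chain of inequalities therefore alternates between
  the growth of \<open>b\<close> and that of \<open>a\<close> in their first halves.\<close>

lemma alternatingly_increasing_of_decomposition:
  assumes p: "p = a + [:0, 1:] * b" and d: "degree p = Suc e"
    and a: "symmetric_wrt (Suc e) a" "\<And>i. 2 * i + 1 \<le> Suc e \<Longrightarrow> coeff a i \<le> coeff a (Suc i)"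
    and b: "symmetric_wrt e b" "\<And>i. 2 * i + 1 \<le> e \<Longrightarrow> coeff b i \<le> coeff b (Suc i)"
    and b0: "coeff b 0 \<ge> 0"
  shows "alternatingly_increasing p"
  unfolding alternatingly_increasing_def d
proof (intro allI impI)
  fix t assume t: "t < Suc e"
  have p0: "coeff p i = coeff a i + (case i of 0 \<Rightarrow> 0 | Suc j \<Rightarrow> coeff b j)" for i
    by (simp add: p coeff_pCons)
  have top: "coeff p (Suc e - i) = coeff a i + coeff b i" if "i \<le> e" for i
    using symmetric_wrt_coeff[OF a(1), of i] symmetric_wrt_coeff[OF b(1), of i] that
    by (simp add: p0 Suc_diff_le)
  show "coeff p (alternating_index (Suc e) t) \<le> coeff p (alternating_index (Suc e) (t + 1))"
  proof (cases "even t")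
    case True
    then obtain i where i: "t = 2 * i" by (elim evenE)
    have "(case i of 0 \<Rightarrow> 0 | Suc j \<Rightarrow> coeff b j) \<le> coeff b i"
      using b0 b(2)[of "i - 1"] t i by (auto split: nat.split)
    then have "coeff p i \<le> coeff p (Suc e - i)" using t i top[of i] p0[of i] by simp
    then show ?thesis by (simp add: alternating_index_def i)
  next
    case False
    then obtain i where i: "t = 2 * i + 1" by (elim oddE)
    then have "coeff p (Suc e - i) \<le> coeff p (Suc i)"
      using t top[of i] p0[of "Suc i"] a(2)[of i] by simp
    then show ?thesis by (simp add: alternating_index_def i)
  qed
qed

lemma symmetric_decomposition_eqI:
  assumes "degree p \<le> N" "is_symmetric_decomposition N p ab"
  shows "symmetric_decomposition N p = ab"
  unfolding symmetric_decomposition_def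
  by (rule the1_equality[OF ex1_symmetric_decomposition]) fact+

lemma smult_sum: "smult c (\<Sum>i\<in>I. f i) = (\<Sum>i\<in>I. smult c (f i))"
  by (induction I rule: infinite_finite_induct) (simp_all add: smult_add_right)

text \<open>Positivity of \<open>c 0\<close> and \<open>c (Suc e)\<close> makes the weights of
  \<open>A\<close> and of its symmetric part strictly positive, as the monotone criterion demands.
  The hypothesis \<open>dom\<close> is the nonnegativity of the weights \<open>S k\<close> of the
  second part.\<close>

lemma refined_Eulerian_combination_properties:
  fixes c :: "nat \<Rightarrow> real" and e :: nat
  defines "A \<equiv> \<Sum>i\<le>Suc e. smult (c i) (refined_Eulerian (Suc e) i)"
  defines "a \<equiv> fst (symmetric_decomposition (Suc e) A)"
    and "b \<equiv> snd (symmetric_decomposition (Suc e) A)"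
  assumes nn: "\<And>i. i \<le> Suc e \<Longrightarrow> c i \<ge> 0" and c0: "c 0 > 0" and ce: "c (Suc e) > 0"
    and dom: "\<And>k. k \<le> e \<Longrightarrow> (\<Sum>j\<le>k. c j) \<le> (\<Sum>j\<le>k. c (Suc e - j))"
  shows "real_rooted A \<and> log_concave A \<and> unimodal A \<and> alternatingly_increasing A
       \<and> bi_gamma_positive (Suc e) A
       \<and> real_rooted a \<and> real_rooted b
       \<and> log_concave a \<and> log_concave b
       \<and> unimodal a \<and> unimodal b"
proof -
  let ?T = "refined_Eulerian e"
  define C where "C k = (\<Sum>j\<le>k. c j)" for k
  define S where "S k = C (Suc e) - C (e - k) - C k" for k
  define a' where "a' = (\<Sum>k\<le>e. [:C k, C (e - k):] * ?T k)"
  define b' where "b' = (\<Sum>k\<le>e. smult (S k) (?T k))"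
  have tail: "C (Suc e) - C k = (\<Sum>j\<in>{k<..Suc e}. c j)" if "k \<le> Suc e" for k
  proof -
    have "{..Suc e} = {..k} \<union> {k<..Suc e}" using that by auto
    then have "C (Suc e) = C k + (\<Sum>j\<in>{k<..Suc e}. c j)"
      unfolding C_def by (simp add: sum.union_disjoint ivl_disj_int)
    then show ?thesis by simp
  qed
  have Cpos: "C k > 0" if "k \<le> e" for k
    unfolding C_def using that nn c0 by (intro sum_pos2[of _ 0]) auto
  have Cmono: "C i \<le> C j" if "i \<le> j" "j \<le> e" for i j
    unfolding C_def using that nn by (intro sum_mono2) auto
  have tail_pos: "C (Suc e) - C k > 0" if "k \<le> e" for k
    using that nn ce tail[of k] by (auto intro!: sum_pos2[of _ "Suc e"])
  have S_nonneg: "S k \<ge> 0" if "k \<le> e" for k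
  proof -
    have "C (Suc e) - C (e - k) = (\<Sum>j\<in>{e - k<..Suc e}. c j)"
      by (rule tail) simp
    also have "\<dots> = (\<Sum>j\<le>k. c (Suc e - j))"
      by (rule sum.reindex_bij_witness[of _ "\<lambda>j. Suc e - j" "\<lambda>j. Suc e - j"]) (use that in auto)
    finally show ?thesis using dom[OF that] by (simp add: S_def C_def)
  qed
  \<comment> \<open>\<open>T (Suc e) i\<close> contains \<open>T e k\<close> with the factor
    \<open>x\<close> exactly for \<open>i > k\<close>, so collecting by \<open>k\<close> yields a
    head and a tail of the sum of \<open>c\<close>.\<close>
  have A: "A = (\<Sum>k\<le>e. [:C k, C (Suc e) - C k:] * ?T k)"
  proof -
    have weight: "(\<Sum>i\<le>Suc e. smult (c i) (if k < i then [:0, 1:] else 1)) = [:C k, C (Suc e) - C k:]"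
      if "k \<le> e" for k
    proof -
      have "{..Suc e} = {..k} \<union> {k<..Suc e}" using that by auto
      then have "(\<Sum>i\<le>Suc e. smult (c i) (if k < i then [:0, 1:] else 1)) =
          (\<Sum>i\<le>k. [:c i:]) + (\<Sum>i\<in>{k<..Suc e}. [:0, c i:])"
        by (simp add: sum.union_disjoint ivl_disj_int)
      also have "\<dots> = [:C k, C (Suc e) - C k:]"
        using tail[of k] that
        by (intro poly_eqI) (auto simp: coeff_sum coeff_pCons C_def split: nat.split)
      finally show ?thesis .
    qed
    have "A = (\<Sum>i\<le>Suc e. \<Sum>k\<le>e. smult (c i) (if k < i then [:0, 1:] else 1) * ?T k)"
      unfolding A_def refined_Eulerian.simps smult_sum mult_smult_left ..
    also have "\<dots> = (\<Sum>k\<le>e. (\<Sum>i\<le>Suc e. smult (c i) (if k < i then [:0, 1:] else 1)) * ?T k)"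
      unfolding sum_distrib_right by (rule sum.swap)
    finally show ?thesis using weight by simp
  qed
  have coeff_nn: "coeff (\<Sum>k\<le>e. [:u k, v k:] * ?T k) i \<ge> 0"
    if "\<And>k. k \<le> e \<Longrightarrow> u k \<ge> 0" "\<And>k. k \<le> e \<Longrightarrow> v k \<ge> 0" for u v i
    unfolding coeff_sum using that refined_Eulerian_nonneg
    by (intro sum_nonneg) (auto simp: coeff_pCons split: nat.split)
  have deg: "degree (\<Sum>k\<le>e. [:u k, v k:] * ?T k) \<le> Suc e" for u v
  proof (intro degree_sum_le)
    fix k
    have "degree ([:u k, v k:] * ?T k) \<le> degree [:u k, v k:] + degree (?T k)" by (rule degree_mult_le)
    also have "\<dots> \<le> 1 + e" using degree_refined_Eulerian[of e k] by (intro add_mono) auto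
    finally show "degree ([:u k, v k:] * ?T k) \<le> Suc e" by simp
  qed auto
  have a'_nn: "coeff a' i \<ge> 0" for i
    unfolding a'_def by (rule coeff_nn) (simp_all add: less_imp_le Cpos)
  have A_nn: "coeff A i \<ge> 0" for i
    unfolding A using Cpos tail_pos by (intro coeff_nn) (auto intro: less_imp_le)
  have b'_nn: "coeff b' i \<ge> 0" for i
    unfolding b'_def coeff_sum using S_nonneg refined_Eulerian_nonneg by (auto intro!: sum_nonneg)
  have sym_a': "symmetric_wrt (Suc e) a'"
  proof (rule symmetric_wrtI)
    show "degree a' \<le> Suc e" unfolding a'_def by (rule deg)
    fix x :: real assume x: "x > 0"
    have "x ^ Suc e * poly a' (1 / x) =
        (\<Sum>k\<le>e. (C (e - k) + x * C k) * (x ^ e * poly (?T k) (1 / x)))"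
      unfolding a'_def poly_sum sum_distrib_left
      using x by (intro sum.cong refl) (simp add: field_simps)
    also have "\<dots> = (\<Sum>k\<le>e. (C (e - k) + x * C k) * poly (?T (e - k)) x)"
      using x by (intro sum.cong refl) (simp add: refined_Eulerian_reciprocal)
    also have "\<dots> = (\<Sum>k\<le>e. (C k + x * C (e - k)) * poly (?T k) x)"
      by (rule sum.reindex_bij_witness[of _ "\<lambda>k. e - k" "\<lambda>k. e - k"]) auto
    also have "\<dots> = poly a' x" by (simp add: a'_def poly_sum algebra_simps)
    finally show "x ^ Suc e * poly a' (1 / x) = poly a' x" .
  qed
  have sym_b': "symmetric_wrt e b'"
  proof (rule symmetric_wrtI)
    show "degree b' \<le> e" unfolding b'_def
      by (intro degree_sum_le) (auto intro: degree_refined_Eulerian)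
    fix x :: real assume x: "x > 0"
    have "x ^ e * poly b' (1 / x) = (\<Sum>k\<le>e. S k * (x ^ e * poly (?T k) (1 / x)))"
      by (simp add: b'_def poly_sum sum_distrib_left mult_ac)
    also have "\<dots> = (\<Sum>k\<le>e. S k * poly (?T (e - k)) x)"
      using x by (intro sum.cong refl) (simp add: refined_Eulerian_reciprocal)
    \<comment> \<open>The weight \<open>S\<close> is invariant under replacing \<open>k\<close> by
      \<open>e - k\<close>.\<close>
    also have "\<dots> = (\<Sum>k\<le>e. S k * poly (?T k) x)"
      by (rule sum.reindex_bij_witness[of _ "\<lambda>k. e - k" "\<lambda>k. e - k"]) (auto simp: S_def)
    also have "\<dots> = poly b' x" by (simp add: b'_def poly_sum)
    finally show "x ^ e * poly b' (1 / x) = poly b' x" .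
  qed
  have Aab: "A = a' + [:0, 1:] * b'"
  proof -
    have "[:C k, C (Suc e) - C k:] * ?T k =
        [:C k, C (e - k):] * ?T k + [:0, 1:] * smult (S k) (?T k)" for k
    proof -
      have "[:C k, C (Suc e) - C k:] = [:C k, C (e - k):] + [:0, 1:] * [:S k:]"
        by (simp add: S_def)
      then show ?thesis by (simp only: distrib_right mult.assoc) simp
    qed
    then show ?thesis
      unfolding A a'_def b'_def sum_distrib_left sum.distrib[symmetric] by (simp only:)
  qed
  have "is_symmetric_decomposition (Suc e) A (a', b')"
    using Aab sym_a' sym_b' by (simp add: is_symmetric_decomposition_def)
  then have dec: "symmetric_decomposition (Suc e) A = (a', b')"
    by (rule symmetric_decomposition_eqI[rotated]) (simp only: A deg)
  have ab: "a = a'" "b = b'" by (simp_all add: a_def b_def dec)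
  have rr_A: "real_rooted A"
    unfolding A using Cpos Cmono tail_pos by (intro real_rooted_monotone_weights) auto
  have rr_a: "real_rooted a'"
    unfolding a'_def by (rule real_rooted_monotone_weights) (auto intro: Cpos Cmono)
  have rr_b: "real_rooted b'"
    unfolding b'_def using S_nonneg by (rule real_rooted_nonneg_weights)
  note PF = real_rooted_nonneg_imp_PF2[OF rr_A A_nn] real_rooted_nonneg_imp_PF2[OF rr_a a'_nn]
    real_rooted_nonneg_imp_PF2[OF rr_b b'_nn]
  \<comment> \<open>By symmetry this is also the coefficient of index \<open>Suc e\<close> in
    \<open>a'\<close>. It fixes the degree of \<open>A\<close>, on which
    \<open>alternatingly_increasing\<close> depends.\<close>
  have "coeff a' 0 > 0"
  proof -
    have "C 0 * coeff (?T 0) 0 \<le> (\<Sum>k\<le>e. C k * coeff (?T k) 0)"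
      by (rule member_le_sum) (auto intro!: mult_nonneg_nonneg refined_Eulerian_nonneg less_imp_le[OF Cpos])
    moreover have "coeff a' 0 = (\<Sum>k\<le>e. C k * coeff (?T k) 0)"
      by (simp add: a'_def coeff_sum)
    moreover have "C 0 * coeff (?T 0) 0 > 0"
      using coeff_0_refined_Eulerian_0[of e] Cpos[of 0] by (intro mult_pos_pos) auto
    ultimately show ?thesis by linarith
  qed
  moreover have "coeff a' (Suc e) = coeff a' 0"
    using symmetric_wrt_coeff[OF sym_a', of 0] by simp
  ultimately have "coeff A (Suc e) > 0" using b'_nn[of e] by (simp add: Aab)
  then have degA: "degree A = Suc e"
    using deg[of C "\<lambda>k. C (Suc e) - C k"] by (intro antisym le_degree) (auto simp: A)
  have "alternatingly_increasing A"
    by (rule alternatingly_increasing_of_decomposition[OF Aab degA sym_a' _ sym_b' _ b'_nn])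
      (rule PF2_symmetric_increasing[OF PF(2) a'_nn sym_a']
            PF2_symmetric_increasing[OF PF(3) b'_nn sym_b'], assumption)+
  moreover have "bi_gamma_positive (Suc e) A"
    unfolding bi_gamma_positive_def dec
    using real_rooted_symmetric_imp_gamma_positive[OF rr_a a'_nn sym_a']
      real_rooted_symmetric_imp_gamma_positive[OF rr_b b'_nn sym_b'] by simp
  ultimately show ?thesis
    unfolding ab using rr_A rr_a rr_b PF[THEN PF2_imp_log_concave]
      PF2_imp_unimodal[OF PF(1) A_nn] PF2_imp_unimodal[OF PF(2) a'_nn]
      PF2_imp_unimodal[OF PF(3) b'_nn] by blast
qed

section \<open>The weights of the colored multiset Eulerian polynomial\<close>

lemma degree_prod_linear_le:
  "degree (\<Prod>j\<in>J. [:a j, b j:]) \<le> card J" for a b :: "'a \<Rightarrow> real"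
proof (cases "finite J")
  case True
  then have "degree (\<Prod>j\<in>J. [:a j, b j:]) \<le> (\<Sum>j\<in>J. degree [:a j, b j:])"
    by (rule degree_prod_sum_le[unfolded comp_def])
  also have "\<dots> \<le> (\<Sum>j\<in>J. 1)" by (intro sum_mono) auto
  finally show ?thesis by simp
qed auto

lemma coeff_prod_linear_nonneg:
  fixes a b :: "'a \<Rightarrow> real"
  assumes "\<And>j. j \<in> J \<Longrightarrow> a j \<ge> 0" "\<And>j. j \<in> J \<Longrightarrow> b j \<ge> 0"
  shows "coeff (\<Prod>j\<in>J. [:a j, b j:]) i \<ge> 0"
  using assms
  by (induction J arbitrary: i rule: infinite_finite_induct)
    (auto simp: coeff_pCons split: nat.split)

lemma coeff_0_prod_linear: "coeff (\<Prod>j\<in>J. [:a j, b j:]) 0 = (\<Prod>j\<in>J. a j :: real)"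
  unfolding poly_0_coeff_0[symmetric] poly_prod by simp

text \<open>Exchanging the two coefficients of each factor reverses the product with respect to its
  formal degree \<open>card J\<close>; the true degree is smaller when some \<open>b j\<close>
  vanishes.\<close>

lemma coeff_prod_linear_reverse:
  fixes a b :: "'a \<Rightarrow> real"
  assumes "finite J" "i \<le> card J"
  shows "coeff (\<Prod>j\<in>J. [:b j, a j:]) i = coeff (\<Prod>j\<in>J. [:a j, b j:]) (card J - i)"
  using assms
proof (induction J arbitrary: i rule: finite_induct)
  case (insert x J)
  let ?F = "\<Prod>j\<in>J. [:a j, b j:]" and ?G = "\<Prod>j\<in>J. [:b j, a j:]"
  have top: "coeff ?F (Suc (card J)) = 0" "coeff ?G (Suc (card J)) = 0"
    using degree_prod_linear_le[of a b J] degree_prod_linear_le[of b a J] by (simp_all add: coeff_eq_0)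
  show ?case
  proof (cases i)
    case 0
    then show ?thesis using insert insert.IH[of 0] top by simp
  next
    case (Suc l)
    show ?thesis
    proof (cases "l = card J")
      case True
      then show ?thesis using insert insert.IH[of l] top Suc by simp
    next
      case False
      then have "l < card J" using insert Suc by simp
      then have "card J - l = Suc (card J - Suc l)" by simp
      then show ?thesis
        using insert insert.IH[of l] insert.IH[of "Suc l"] Suc \<open>l < card J\<close> by simp
    qed
  qed
qed auto

text \<open>This is homogenization of the product; with \<open>x = t\<close> and
  \<open>y = 1 + t\<close> it yields the basis \<open>t ^ i * (1 + t) ^ (M - i)\<close>.\<close>

lemma homogenized_prod_linear:
  fixes a b :: "'a \<Rightarrow> real"
  assumes "finite J"
  shows "(\<Sum>i\<le>card J. coeff (\<Prod>j\<in>J. [:a j, b j:]) i * (x ^ i * y ^ (card J - i))) =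
    (\<Prod>j\<in>J. a j * y + b j * x)"
  using assms
proof (induction J rule: finite_induct)
  case (insert p J)
  let ?F = "\<Prod>j\<in>J. [:a j, b j:]" and ?N = "card J"
  have top: "coeff ?F (Suc ?N) = 0"
    using degree_prod_linear_le[of a b J] by (simp add: coeff_eq_0)
  define H where "H = (\<Sum>i\<le>?N. coeff ?F i * (x ^ i * y ^ (?N - i)))"
  have "(\<Sum>i\<le>Suc ?N. coeff ([:a p, b p:] * ?F) i * (x ^ i * y ^ (Suc ?N - i))) =
      (\<Sum>i\<le>Suc ?N. a p * (coeff ?F i * (x ^ i * y ^ (Suc ?N - i))))
      + (\<Sum>i\<le>Suc ?N. b p * ((case i of 0 \<Rightarrow> 0 | Suc l \<Rightarrow> coeff ?F l) * (x ^ i * y ^ (Suc ?N - i))))"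
    unfolding sum.distrib[symmetric]
    by (intro sum.cong refl) (auto simp: coeff_pCons algebra_simps split: nat.split)
  also have "(\<Sum>i\<le>Suc ?N. a p * (coeff ?F i * (x ^ i * y ^ (Suc ?N - i)))) = a p * y * H"
    unfolding H_def sum_distrib_left
    by (simp add: top Suc_diff_le) (simp add: mult_ac)
  also have "(\<Sum>i\<le>Suc ?N. b p * ((case i of 0 \<Rightarrow> 0 | Suc l \<Rightarrow> coeff ?F l) * (x ^ i * y ^ (Suc ?N - i)))) =
      b p * x * H"
    unfolding H_def sum_distrib_left sum.atMost_Suc_shift
    by (simp add: mult_ac)
  also have "a p * y * H + b p * x * H = (a p * y + b p * x) * H" by (simp add: algebra_simps)
  finally show ?case using insert by (simp add: H_def)
qed auto

text \<open>Each factor keeps its value at 1 while weight moves from the coefficient of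
  \<open>x\<close> to the constant term, so the difference is divisible by \<open>1 - x\<close>.
  Nonnegativity of the quotient gives dominance of partial sums.\<close>

lemma prod_linear_diff:
  fixes a b a' b' :: "'a \<Rightarrow> real"
  assumes "finite J"
    and "\<And>j. j \<in> J \<Longrightarrow> 0 \<le> a j \<and> 0 \<le> b j \<and> 0 \<le> b' j \<and> a j \<le> a' j \<and> a j + b j = a' j + b' j"
  shows "\<exists>u. (\<forall>i. coeff u i \<ge> 0) \<and>
    (\<Prod>j\<in>J. [:a' j, b' j:]) - (\<Prod>j\<in>J. [:a j, b j:]) = [:1, -1:] * u"
  using assms
proof (induction J rule: finite_induct)
  case empty
  show ?case by (intro exI[of _ 0]) auto
next
  case (insert p J)
  then obtain u where u: "\<forall>i. coeff u i \<ge> 0"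
    "(\<Prod>j\<in>J. [:a' j, b' j:]) - (\<Prod>j\<in>J. [:a j, b j:]) = [:1, -1:] * u" by blast
  let ?F = "\<Prod>j\<in>J. [:a j, b j:]" and ?G = "\<Prod>j\<in>J. [:a' j, b' j:]"
  have p: "0 \<le> a p" "0 \<le> b' p" "a p \<le> a' p" "a p + b p = a' p + b' p" using insert by auto
  \<comment> \<open>The quotient by \<open>1 - x\<close> of the telescoped difference: change the
    product over \<open>J\<close> first, then the new factor.\<close>
  define w where "w = [:a' p, b' p:] * u + [:a' p - a p:] * ?F"
  have "coeff ?F i \<ge> 0" for i by (rule coeff_prod_linear_nonneg) (use insert.prems in auto)
  then have "coeff w i \<ge> 0" for i
    using p u(1)
    by (auto simp: w_def coeff_pCons intro!: add_nonneg_nonneg mult_nonneg_nonneg split: nat.split)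
  moreover have "[:a' p, b' p:] * ?G - [:a p, b p:] * ?F = [:1, -1:] * w"
  proof -
    have "[:a' p, b' p:] - [:a p, b p:] = [:1, -1:] * [:a' p - a p:]" using p by simp
    then have "[:a' p, b' p:] * ?G - [:a p, b p:] * ?F =
        [:a' p, b' p:] * ([:1, -1:] * u) + [:1, -1:] * [:a' p - a p:] * ?F"
      using u(2) by (simp only: left_diff_distrib right_diff_distrib flip: u(2)) algebra
    also have "\<dots> = [:1, -1:] * w" unfolding w_def by (simp only: distrib_left ac_simps)
    finally show ?thesis .
  qed
  ultimately show ?case using insert(1,2) by auto
qed

text \<open>A telescoping sum, which turns the factor \<open>1 - x\<close> of the previous lemma
  into an inequality between partial sums.\<close>

lemma partial_sums_mult_one_minus_X:
  fixes u :: "real poly"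
  shows "(\<Sum>j\<le>k. coeff ([:1, -1:] * u) j) = coeff u k"
  by (induction k) (auto simp: coeff_pCons)

section \<open>Expansion in refined Eulerian polynomials\<close>

lemma real_binomial_eq_prod:
  "real ((N + m) choose m) = (\<Prod>i=1..m. (real N + real i) / real i)"
proof (induction m)
  case (Suc m)
  have "Suc (N + m) * ((N + m) choose m) = (Suc (N + m) choose Suc m) * Suc m"
    by (rule Suc_times_binomial_eq)
  then have "real (Suc (N + m)) * real ((N + m) choose m) = real (Suc (N + m) choose Suc m) * real (Suc m)"
    by (metis of_nat_mult)
  then have "real ((N + Suc m) choose Suc m) = real ((N + m) choose m) * (real (N + Suc m) / real (Suc m))"
    by (simp add: field_simps)
  then show ?case using Suc by simp
qed auto

text \<open>Each monomial \<open>x ^ des\<close> is written as \<open>(1 - x) ^ (M + 1)\<close>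
  times a shifted binomial series; the Worpitzky identity then sums these series
  coefficientwise.\<close>

lemma colored_multiset_Eulerian_fps:
  assumes r: "\<And>k. k \<in> {1..n} \<Longrightarrow> r k > 0"
  shows "fps_of_poly (colored_multiset_Eulerian n m r) =
    (1 - fps_X) ^ Suc (sum m {1..n}) * Abs_fps (\<lambda>t. \<Prod>k=1..n. real ((r k * t + m k) choose m k))"
proof -
  let ?W = "colored_multiset_perms n m r" and ?M = "sum m {1..n}"
  have "fps_of_poly (colored_multiset_Eulerian n m r) = (\<Sum>w\<in>?W. fps_X ^ des n w)"
    by (simp add: colored_multiset_Eulerian_def fps_of_poly_sum fps_of_poly_monom')
  also have "\<dots> = (\<Sum>w\<in>?W. (1 - fps_X) ^ Suc ?M * Abs_fps (\<lambda>t. real ((t + ?M - des n w) choose ?M)))"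
  proof (intro sum.cong refl)
    fix w assume "w \<in> ?W"
    then have "des n w \<le> ?M" using des_le[of n w] by (simp add: colored_multiset_perms_def)
    then show "fps_X ^ des n w =
        (1 - fps_X) ^ Suc ?M * Abs_fps (\<lambda>t. real ((t + ?M - des n w) choose ?M))"
      by (rule fps_shifted_binomial_series[symmetric])
  qed
  also have "\<dots> = (1 - fps_X) ^ Suc ?M *
      (\<Sum>w\<in>?W. Abs_fps (\<lambda>t. real ((t + ?M - des n w) choose ?M)))"
    by (simp only: sum_distrib_left)
  also have "(\<Sum>w\<in>?W. Abs_fps (\<lambda>t. real ((t + ?M - des n w) choose ?M))) =
      Abs_fps (\<lambda>t. \<Prod>k=1..n. real ((r k * t + m k) choose m k))"
  proof (rule fps_ext)
    fix t
    have "(\<Sum>w\<in>?W. Abs_fps (\<lambda>t. real ((t + ?M - des n w) choose ?M))) $ t =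
        real (\<Sum>w\<in>?W. (t + ?M - des n w) choose ?M)"
      by (simp add: fps_sum_nth)
    also have "\<dots> = real (\<Prod>k=1..n. (r k * t + m k) choose m k)"
      using colored_Worpitzky[of n r t m] r by simp
    finally show "(\<Sum>w\<in>?W. Abs_fps (\<lambda>t. real ((t + ?M - des n w) choose ?M))) $ t =
        Abs_fps (\<lambda>t. \<Prod>k=1..n. real ((r k * t + m k) choose m k)) $ t" by simp
  qed
  finally show ?thesis .
qed

lemma colored_multiset_Eulerian_eq_combination:
  fixes m r :: "nat \<Rightarrow> nat"
  assumes r: "\<And>k. k \<in> {1..n} \<Longrightarrow> r k > 0"
  defines "J \<equiv> SIGMA k:{1..n}. {1..m k}"
  defines "c \<equiv> \<lambda>i. coeff (\<Prod>(k, j)\<in>J. [:real j, real (r k) - real j:]) i / (\<Prod>(k, j)\<in>J. real j)"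
  shows "colored_multiset_Eulerian n m r =
    (\<Sum>i\<le>sum m {1..n}. smult (c i) (refined_Eulerian (sum m {1..n}) i))"
proof -
  let ?M = "sum m {1..n}"
  define a b where "a = (\<lambda>(k::nat, j). real j)" and "b = (\<lambda>(k, j). real (r k) - real j)"
  have J: "finite J" "card J = ?M" by (simp_all add: J_def)
  have c: "c i = coeff (\<Prod>p\<in>J. [:a p, b p:]) i / (\<Prod>p\<in>J. a p)" for i
    by (simp add: c_def a_def b_def case_prod_unfold)
  have val: "(\<Prod>k=1..n. real ((r k * t + m k) choose m k)) =
      (\<Sum>i\<le>?M. c i * (real t ^ i * (1 + real t) ^ (?M - i)))" for t
  proof -
    have "(\<Prod>k=1..n. real ((r k * t + m k) choose m k)) =
        (\<Prod>k=1..n. \<Prod>j=1..m k. (real (r k * t) + real j) / real j)"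
      by (simp only: real_binomial_eq_prod)
    \<comment> \<open>Each numerator is rewritten by
      \<open>r k * t + j = j * (1 + t) + (r k - j) * t\<close>.\<close>
    also have "\<dots> = (\<Prod>p\<in>J. (a p * (1 + real t) + b p * real t) / a p)"
      unfolding J_def by (subst prod.Sigma) (auto simp: a_def b_def algebra_simps intro!: prod.cong)
    also have "\<dots> = (\<Sum>i\<le>?M. coeff (\<Prod>p\<in>J. [:a p, b p:]) i * (real t ^ i * (1 + real t) ^ (?M - i)))
        / (\<Prod>p\<in>J. a p)"
      unfolding prod_dividef homogenized_prod_linear[OF J(1), symmetric] J(2) ..
    finally show ?thesis by (simp add: c sum_divide_distrib)
  qed
  have "fps_of_poly (colored_multiset_Eulerian n m r) =
      (1 - fps_X) ^ Suc ?M * Abs_fps (\<lambda>t. \<Sum>i\<le>?M. c i * (real t ^ i * (1 + real t) ^ (?M - i)))"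
    using colored_multiset_Eulerian_fps[of n r m] r by (simp only: val)
  also have "Abs_fps (\<lambda>t. \<Sum>i\<le>?M. c i * (real t ^ i * (1 + real t) ^ (?M - i))) =
      (\<Sum>i\<le>?M. fps_const (c i) * Abs_fps (\<lambda>t. real t ^ i * (1 + real t) ^ (?M - i)))"
    by (rule fps_ext) (simp add: fps_sum_nth)
  also have "(1 - fps_X) ^ Suc ?M * \<dots> =
      (\<Sum>i\<le>?M. fps_const (c i) * ((1 - fps_X) ^ Suc ?M * Abs_fps (\<lambda>t. real t ^ i * (1 + real t) ^ (?M - i))))"
    by (simp only: sum_distrib_left ac_simps)
  also have "\<dots> = (\<Sum>i\<le>?M. fps_of_poly (smult (c i) (refined_Eulerian ?M i)))"
    by (intro sum.cong refl) (simp only: fps_of_poly_smult fps_refined_Eulerian atMost_iff)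
  also have "\<dots> = fps_of_poly (\<Sum>i\<le>?M. smult (c i) (refined_Eulerian ?M i))"
    by (simp only: fps_of_poly_sum)
  finally show ?thesis by (simp only: fps_of_poly_eq_iff)
qed

theorem corollary21:
  fixes n :: nat and m r :: "nat \<Rightarrow> nat" and M :: nat and A a b :: "real poly"
  assumes "n \<ge> 1"
    and "\<forall>j\<in>{1..n}. m j > 0"
    and "\<forall>j\<in>{1..n}. r j > 0"
    and "\<forall>j\<in>{1..n}. r j \<ge> m j + 1"
  defines "M \<equiv> (\<Sum>j=1..n. m j)"
    and "A \<equiv> colored_multiset_Eulerian n m r"
    and "a \<equiv> fst (symmetric_decomposition M A)"
    and "b \<equiv> snd (symmetric_decomposition M A)"
  shows "real_rooted A \<and> log_concave A \<and> unimodal A \<and> alternatingly_increasing A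
       \<and> bi_gamma_positive M A
       \<and> real_rooted a \<and> real_rooted b
       \<and> log_concave a \<and> log_concave b
       \<and> unimodal a \<and> unimodal b"
proof -
  define J where "J = (SIGMA k:{1..n}. {1..m k})"
  define \<alpha> \<beta> where "\<alpha> = (\<lambda>(k::nat, j). real j)" and "\<beta> = (\<lambda>(k, j). real (r k) - real j)"
  define \<kappa> where "\<kappa> = (\<Prod>(k, j)\<in>J. real j)"
  define F where "F = (\<Prod>p\<in>J. [:\<alpha> p, \<beta> p:])"
  define c where "c i = coeff F i / \<kappa>" for i
  have J: "finite J" "card J = M" by (simp_all add: J_def M_def)
  have mr: "m k + 1 \<le> r k" if "k \<in> {1..n}" for k using assms(4) that by blast
  have pos: "\<alpha> p > 0" "\<beta> p > 0" if "p \<in> J" for p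
    using that mr by (fastforce simp: J_def \<alpha>_def \<beta>_def)+
  have \<kappa>: "\<kappa> > 0" unfolding \<kappa>_def by (rule prod_pos) (auto simp: J_def)
  have "M > 0"
  proof -
    have "m 1 \<le> M" unfolding M_def using assms(1) by (intro member_le_sum) auto
    then show ?thesis using assms(1,2) by (metis atLeastAtMost_iff le_refl less_le_trans)
  qed
  then obtain e where e: "M = Suc e" using gr0_conv_Suc by blast
  have A: "A = (\<Sum>i\<le>Suc e. smult (c i) (refined_Eulerian (Suc e) i))"
    using colored_multiset_Eulerian_eq_combination[of n r m] assms(3)
    unfolding A_def e[symmetric] M_def c_def F_def \<kappa>_def J_def \<alpha>_def \<beta>_def
    by (simp add: case_prod_unfold)
  have rev: "coeff (\<Prod>p\<in>J. [:\<beta> p, \<alpha> p:]) i = coeff F (M - i)" if "i \<le> M" for i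
    unfolding F_def using coeff_prod_linear_reverse[OF J(1), of i \<beta> \<alpha>] that J(2) by simp
  have nn: "c i \<ge> 0" for i
    unfolding c_def F_def using \<kappa> pos by (intro divide_nonneg_pos coeff_prod_linear_nonneg) (auto intro: less_imp_le)
  have "coeff F 0 = (\<Prod>p\<in>J. \<alpha> p)" by (simp add: F_def coeff_0_prod_linear)
  then have c0: "c 0 > 0" unfolding c_def using \<kappa> pos by (auto intro!: divide_pos_pos prod_pos)
  have "coeff F M = (\<Prod>p\<in>J. \<beta> p)" using rev[of 0] by (simp add: coeff_0_prod_linear)
  then have ce: "c (Suc e) > 0" unfolding c_def e[symmetric] using \<kappa> pos by (auto intro!: divide_pos_pos prod_pos)
  have dom: "(\<Sum>j\<le>k. c j) \<le> (\<Sum>j\<le>k. c (Suc e - j))" if "k \<le> e" for k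
  proof -
    \<comment> \<open>Substituting \<open>m k + 1 - j\<close> for \<open>j\<close> in the reversed
      factors: for fixed \<open>k\<close>, \<open>\<alpha>'\<close> lists the numbers
      \<open>r k - j\<close> in increasing order, and \<open>\<alpha> \<le> \<alpha>'\<close>
      amounts to \<open>r k \<ge> m k + 1\<close>.\<close>
    define \<alpha>' \<beta>' where "\<alpha>' = (\<lambda>(k, j). real (r k) - real (m k) - 1 + real j)"
      and "\<beta>' = (\<lambda>(k, j). real (m k) + 1 - real j)"
    have "(\<Prod>p\<in>J. [:\<beta> p, \<alpha> p:]) = (\<Prod>p\<in>J. [:\<alpha>' p, \<beta>' p:])"
      by (rule prod.reindex_bij_witness[of _ "\<lambda>(k, j). (k, m k + 1 - j)" "\<lambda>(k, j). (k, m k + 1 - j)"])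
        (auto simp: J_def \<alpha>_def \<beta>_def \<alpha>'_def \<beta>'_def of_nat_diff)
    moreover have "\<exists>u. (\<forall>i. coeff u i \<ge> 0) \<and>
        (\<Prod>p\<in>J. [:\<alpha>' p, \<beta>' p:]) - (\<Prod>p\<in>J. [:\<alpha> p, \<beta> p:]) = [:1, -1:] * u"
    proof (rule prod_linear_diff[OF J(1)])
      fix p assume p: "p \<in> J"
      then obtain k j where kj: "p = (k, j)" "k \<in> {1..n}" "j \<in> {1..m k}" by (auto simp: J_def)
      have "real (m k) + 1 \<le> real (r k)" using mr[OF kj(2)] by linarith
      then show "0 \<le> \<alpha> p \<and> 0 \<le> \<beta> p \<and> 0 \<le> \<beta>' p \<and> \<alpha> p \<le> \<alpha>' p \<and> \<alpha> p + \<beta> p = \<alpha>' p + \<beta>' p"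
        using kj(3) by (auto simp: kj(1) \<alpha>_def \<beta>_def \<alpha>'_def \<beta>'_def)
    qed
    ultimately obtain u where u: "\<forall>i. coeff u i \<ge> 0" "(\<Prod>p\<in>J. [:\<beta> p, \<alpha> p:]) - F = [:1, -1:] * u"
      unfolding F_def by metis
    \<comment> \<open>The reversed product has coefficients \<open>coeff F (M - j)\<close>, so the
      gap between the two partial sums is the coefficient of \<open>u\<close> at \<open>k\<close>,
      which is nonnegative.\<close>
    have "(\<Sum>j\<le>k. coeff F (M - j) - coeff F j) = (\<Sum>j\<le>k. coeff ([:1, -1:] * u) j)"
      unfolding u(2)[symmetric] coeff_diff using that e by (intro sum.cong) (auto simp: rev)
    then have "(\<Sum>j\<le>k. coeff F (M - j)) - (\<Sum>j\<le>k. coeff F j) = coeff u k"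
      by (simp only: partial_sums_mult_one_minus_X sum_subtractf)
    then have "(\<Sum>j\<le>k. coeff F j) \<le> (\<Sum>j\<le>k. coeff F (M - j))"
      using u(1)[rule_format, of k] by linarith
    then show ?thesis
      using \<kappa> by (simp add: c_def e sum_divide_distrib[symmetric] divide_right_mono)
  qed
  show ?thesis
    unfolding a_def b_def A e
    by (rule refined_Eulerian_combination_properties) (use nn c0 ce dom in auto)
qed

end
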